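(* There exists an orientation-preserving $C^{\infty}$ diffeomorphism $\bar f$ of a closed interval $I$ that is undistorted in $\mathrm{Diff}^2_+(I)$ and has the following property: for every sequence $(k_n)_{n\ge 1}$ of positive integers diverging to infinity, there exists a finitely generated subgroup $\Gamma\subset \mathrm{Diff}^1_+(I)$ containing $\bar f$ such that $\|\bar f^n\|_{\Gamma}=o(k_n\log(n))$ as $n\to\infty$.
   Context: For an integer $r\ge 1$, $\mathrm{Diff}^r_+(I)$ is the group (under composition) of orientation-preserving $C^r$ diffeomorphisms of the closed interval $I$ (smooth up to the endpoints, with inverse of class $C^r$). For a finitely generated group $\Gamma$, $\|\cdot\|_{\Gamma}$ is the word-length with respect to some fixed finite generating system (a different choice gives a bi-Lipschitz equivalent length). An element $f$ of a group $G$ is distorted in $G$ if there exists a finitely generated subgroup $\Gamma\subset G$ containing $f$ such that $\lim_{n\to\infty}\|f^n\|_{\Gamma}/n=0$, and undistorted in $G$ otherwise. *)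

theory Defs
  imports
    "HOL-Algebra.Bij"
    "HOL-Algebra.Generated_Groups"
    "HOL-Library.Extended_Nat"
    "HOL-Library.Landau_Symbols"
begin

subsection \<open>Functions of class \<open>C\<^sup>r\<close>\<close>

text \<open>Derivatives are taken within \<open>S\<close>; for a nondegenerate closed interval they are one-sided
  at the endpoints, so that \<open>Ck_on k {a..b} f\<close> expresses regularity up to the boundary.\<close>

primrec Ck_on :: "nat \<Rightarrow> real set \<Rightarrow> (real \<Rightarrow> real) \<Rightarrow> bool" where
  "Ck_on 0 S f \<longleftrightarrow> continuous_on S f"
| "Ck_on (Suc k) S f \<longleftrightarrow>
     (\<exists>f'. (\<forall>x\<in>S. (f has_real_derivative f' x) (at x within S)) \<and> Ck_on k S f')"

definition C_on :: "enat \<Rightarrow> real set \<Rightarrow> (real \<Rightarrow> real) \<Rightarrow> bool" where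
  "C_on r S f \<longleftrightarrow> (\<forall>k. enat k \<le> r \<longrightarrow> Ck_on k S f)"


subsection \<open>The group \<open>Diff\<^sup>r\<^sub>+([a,b])\<close>\<close>

text \<open>As in \<^const>\<open>BijGroup\<close>, a self-map of the interval is represented by a function that is
  \<^const>\<open>undefined\<close> outside it; the group operation is composition on the interval.\<close>

definition Diff :: "enat \<Rightarrow> real \<Rightarrow> real \<Rightarrow> (real \<Rightarrow> real) monoid" where
  "Diff r a b = (BijGroup {a..b})
     \<lparr>carrier := {f \<in> Bij {a..b}. strict_mono_on {a..b} f \<and>
                    C_on r {a..b} f \<and> C_on r {a..b} (inv_into {a..b} f)}\<rparr>"


subsection \<open>Word length and distortion\<close>

definition finite_generating_set :: "('a, 'b) monoid_scheme \<Rightarrow> 'a set \<Rightarrow> 'a set \<Rightarrow> bool" where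
  "finite_generating_set G \<Gamma> S \<longleftrightarrow> finite S \<and> S \<subseteq> carrier G \<and> generate G S = \<Gamma>"

text \<open>Meaningful for \<open>g \<in> generate G S\<close> only: otherwise no word represents \<open>g\<close> and the least
  element is arbitrary.\<close>

definition word_length :: "('a, 'b) monoid_scheme \<Rightarrow> 'a set \<Rightarrow> 'a \<Rightarrow> nat" where
  "word_length G S g =
     (LEAST n. \<exists>w. length w = n \<and> set w \<subseteq> S \<union> (\<lambda>s. inv\<^bsub>G\<^esub> s) ` S \<and>
                   foldr (\<lambda>x y. x \<otimes>\<^bsub>G\<^esub> y) w \<one>\<^bsub>G\<^esub> = g)"

text \<open>Different finite generating sets of the same subgroup give bi-Lipschitz equivalent word
  lengths, so it does not matter which one is used.\<close>

definition distorted_in :: "('a, 'b) monoid_scheme \<Rightarrow> 'a \<Rightarrow> bool" where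
  "distorted_in G f \<longleftrightarrow>
     (\<exists>\<Gamma> S. subgroup \<Gamma> G \<and> finite_generating_set G \<Gamma> S \<and> f \<in> \<Gamma> \<and>
        (\<lambda>n. real (word_length G S (f [^]\<^bsub>G\<^esub> n)) / real n) \<longlonglongrightarrow> 0)"

definition undistorted_in :: "('a, 'b) monoid_scheme \<Rightarrow> 'a \<Rightarrow> bool" where
  "undistorted_in G f \<longleftrightarrow> f \<in> carrier G \<and> \<not> distorted_in G f"


subsection \<open>\<open>Diff\<^sup>r\<^sub>+([a,b])\<close> is a group\<close>

lemma Ck_on_Suc_imp: "Ck_on (Suc k) S f \<Longrightarrow> Ck_on k S f"
proof (induction k arbitrary: f)
  case 0
  then show ?case
    by (auto simp: continuous_on_eq_continuous_within intro: DERIV_continuous)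
next
  case (Suc k)
  then show ?case by (metis Ck_on.simps(2))
qed

lemma Ck_on_cong: "(\<And>x. x \<in> S \<Longrightarrow> f x = g x) \<Longrightarrow> Ck_on k S f \<longleftrightarrow> Ck_on k S g"
proof (cases k)
  case 0
  moreover assume "\<And>x. x \<in> S \<Longrightarrow> f x = g x"
  ultimately show ?thesis by (simp cong: continuous_on_cong)
next
  case (Suc m)
  assume eq: "\<And>x. x \<in> S \<Longrightarrow> f x = g x"
  have "(f has_real_derivative d) (at x within S) \<longleftrightarrow>
        (g has_real_derivative d) (at x within S)" if "x \<in> S" for x d
    using that eq by (intro has_field_derivative_cong_eventually)
      (auto simp: eventually_at_filter)
  with Suc show ?thesis by auto
qed

lemma Ck_on_add: "Ck_on k S f \<Longrightarrow> Ck_on k S g \<Longrightarrow> Ck_on k S (\<lambda>x. f x + g x)"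
proof (induction k arbitrary: f g)
  case (Suc k)
  then obtain f' g' where
    "\<forall>x\<in>S. (f has_real_derivative f' x) (at x within S)" "Ck_on k S f'"
    "\<forall>x\<in>S. (g has_real_derivative g' x) (at x within S)" "Ck_on k S g'" by auto
  then show ?case
    by (auto intro!: exI[of _ "\<lambda>x. f' x + g' x"] DERIV_add Suc.IH)
qed (simp add: continuous_on_add)

lemma Ck_on_mult: "Ck_on k S f \<Longrightarrow> Ck_on k S g \<Longrightarrow> Ck_on k S (\<lambda>x. f x * g x)"
proof (induction k arbitrary: f g)
  case (Suc k)
  then obtain f' g' where d:
    "\<forall>x\<in>S. (f has_real_derivative f' x) (at x within S)" "Ck_on k S f'"
    "\<forall>x\<in>S. (g has_real_derivative g' x) (at x within S)" "Ck_on k S g'" by auto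
  have "Ck_on k S (\<lambda>x. f' x * g x + g' x * f x)"
    using d Suc.prems by (intro Ck_on_add Suc.IH) (auto dest: Ck_on_Suc_imp simp del: Ck_on.simps)
  then show ?case
    using d by (auto intro!: exI[of _ "\<lambda>x. f' x * g x + g' x * f x"] DERIV_mult)
qed (simp add: continuous_on_mult)

lemma Ck_on_compose:
  assumes "f ` S \<subseteq> S"
  shows "Ck_on k S g \<Longrightarrow> Ck_on k S f \<Longrightarrow> Ck_on k S (\<lambda>x. g (f x))"
proof (induction k arbitrary: g)
  case 0
  then show ?case using assms by (auto intro: continuous_on_compose2)
next
  case (Suc k)
  then obtain f' g' where d:
    "\<forall>x\<in>S. (f has_real_derivative f' x) (at x within S)" "Ck_on k S f'"
    "\<forall>x\<in>S. (g has_real_derivative g' x) (at x within S)" "Ck_on k S g'" by auto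
  have "Ck_on k S (\<lambda>x. g' (f x) * f' x)"
    using Ck_on_mult[OF Suc.IH[OF d(4) Ck_on_Suc_imp[OF Suc.prems(2)]] d(2)] .
  moreover have "((\<lambda>x. g (f x)) has_real_derivative g' (f x) * f' x) (at x within S)"
    if "x \<in> S" for x
  proof -
    have "(g has_real_derivative g' (f x)) (at (f x) within f ` S)"
      using d assms that by (blast intro: DERIV_subset)
    then show ?thesis
      using DERIV_image_chain[of g "g' (f x)" f x S "f' x"] d(1) that by (simp add: o_def)
  qed
  ultimately show ?case
    unfolding Ck_on.simps by (intro exI[of _ "\<lambda>x. g' (f x) * f' x"]) blast
qed

lemma C_on_cong: "(\<And>x. x \<in> S \<Longrightarrow> f x = g x) \<Longrightarrow> C_on r S f \<longleftrightarrow> C_on r S g"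
  unfolding C_on_def using Ck_on_cong by blast

lemma C_on_compose: "f ` S \<subseteq> S \<Longrightarrow> C_on r S g \<Longrightarrow> C_on r S f \<Longrightarrow> C_on r S (\<lambda>x. g (f x))"
  unfolding C_on_def using Ck_on_compose by blast

lemma Ck_on_const: "Ck_on k S (\<lambda>x. c)"
  by (induction k arbitrary: c) (auto intro!: exI[of _ "\<lambda>x. 0"])

lemma Ck_on_ident: "Ck_on k S (\<lambda>x. x)"
  by (cases k) (auto intro!: exI[of _ "\<lambda>x. 1"] Ck_on_const)

lemma subgroup_Diff: "subgroup (carrier (Diff r a b)) (BijGroup {a..b})"
proof -
  let ?I = "{a..b}"
  interpret group "BijGroup ?I" by (rule group_BijGroup)
  have inv_into_compose: "inv_into ?I (compose ?I f g) x = inv_into ?I g (inv_into ?I f x)"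
    if "f \<in> Bij ?I" "g \<in> Bij ?I" "x \<in> ?I" for f g x
  proof -
    let ?y = "inv_into ?I g (inv_into ?I f x)"
    have bij: "bij_betw f ?I ?I" "bij_betw g ?I ?I" using that by (auto simp: Bij_def)
    have fx: "inv_into ?I f x \<in> ?I"
      using bij_betwE[OF bij_betw_inv_into[OF bij(1)]] that(3) by blast
    have "?y \<in> ?I"
      using bij_betwE[OF bij_betw_inv_into[OF bij(2)]] fx by blast
    moreover have "f (g ?y) = x"
      using bij_betw_inv_into_right[OF bij(1) that(3)] bij_betw_inv_into_right[OF bij(2) fx] by simp
    moreover have "inj_on (compose ?I f g) ?I"
      using compose_Bij[OF that(1,2)] by (auto simp: Bij_def bij_betw_def)
    ultimately show ?thesis by (intro inv_into_f_eq) (simp_all add: compose_eq del: atLeastAtMost_iff)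
  qed
  show ?thesis
  proof (rule subgroupI)
    show "carrier (Diff r a b) \<subseteq> carrier (BijGroup ?I)"
      by (auto simp: Diff_def BijGroup_def)
    have "inv_into ?I (\<lambda>x\<in>?I. x) x = x" if "x \<in> ?I" for x
      using that by (intro inv_into_f_eq) (auto simp: inj_on_def)
    then have "C_on r ?I (inv_into ?I (\<lambda>x\<in>?I. x))" "C_on r ?I (\<lambda>x\<in>?I. x)"
      using Ck_on_ident by (subst C_on_cong[of _ _ "\<lambda>x. x"]; simp add: C_on_def)+
    then have "(\<lambda>x\<in>?I. x) \<in> carrier (Diff r a b)"
      using id_Bij[of ?I] by (auto simp: Diff_def strict_mono_on_def)
    then show "carrier (Diff r a b) \<noteq> {}" by blast
  next
    fix f assume "f \<in> carrier (Diff r a b)"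
    then have f: "f \<in> Bij ?I" "strict_mono_on ?I f" "C_on r ?I f" "C_on r ?I (inv_into ?I f)"
      by (auto simp: Diff_def)
    let ?g = "restrict (inv_into ?I f) ?I"
    have bij: "bij_betw f ?I ?I" using f(1) by (auto simp: Bij_def)
    have "strict_mono_on ?I ?g"
    proof (rule strict_mono_onI)
      fix x y assume xy: "x \<in> ?I" "y \<in> ?I" "x < y"
      then have "?g x \<in> ?I" "?g y \<in> ?I" "f (?g x) = x" "f (?g y) = y"
        using bij bij_betwE[OF bij_betw_inv_into[OF bij]]
        by (auto simp: bij_betw_inv_into_right simp del: atLeastAtMost_iff)
      then show "?g x < ?g y"
        using strict_mono_on_leD[OF f(2), of "?g y" "?g x"] xy(3) by (metis leD leI)
    qed
    moreover have "inv_into ?I ?g x = f x" if "x \<in> ?I" for x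
    proof (rule inv_into_f_eq)
      show "inj_on ?g ?I" using restrict_inv_into_Bij[OF f(1)] by (auto simp: Bij_def bij_betw_def)
      show "f x \<in> ?I" using bij that bij_betwE by blast
      then show "?g (f x) = x" using bij that by (auto simp: bij_betw_inv_into_left)
    qed
    then have "C_on r ?I (inv_into ?I ?g)" using f(3) C_on_cong by blast
    moreover have "C_on r ?I ?g" using f(4) by (subst C_on_cong[of _ _ "inv_into ?I f"]) auto
    ultimately show "inv\<^bsub>BijGroup ?I\<^esub> f \<in> carrier (Diff r a b)"
      using f(1) restrict_inv_into_Bij[OF f(1)] by (simp add: inv_BijGroup Diff_def)
  next
    fix f g assume "f \<in> carrier (Diff r a b)" "g \<in> carrier (Diff r a b)"
    then have f: "f \<in> Bij ?I" "strict_mono_on ?I f" "C_on r ?I f" "C_on r ?I (inv_into ?I f)"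
      and g: "g \<in> Bij ?I" "strict_mono_on ?I g" "C_on r ?I g" "C_on r ?I (inv_into ?I g)"
      by (auto simp: Diff_def)
    have im: "g ` ?I \<subseteq> ?I" "inv_into ?I f ` ?I \<subseteq> ?I"
      using f(1) g(1) by (auto simp: Bij_def bij_betw_def inv_into_into simp del: atLeastAtMost_iff)
    have "strict_mono_on ?I (compose ?I f g)"
      using f(2) g(2) im(1) unfolding strict_mono_on_def
      by (auto simp: compose_def image_subset_iff simp del: atLeastAtMost_iff)
    moreover have "C_on r ?I (compose ?I f g)"
      using C_on_compose[OF im(1) f(3) g(3)]
      by (subst C_on_cong[of _ _ "\<lambda>x. f (g x)"]) (auto simp: compose_eq)
    moreover have "C_on r ?I (inv_into ?I (compose ?I f g))"
      using C_on_compose[OF im(2) g(4) f(4)] inv_into_compose[OF f(1) g(1)]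
      by (subst C_on_cong[of _ _ "\<lambda>x. inv_into ?I g (inv_into ?I f x)"])
    ultimately show "f \<otimes>\<^bsub>BijGroup ?I\<^esub> g \<in> carrier (Diff r a b)"
      using compose_Bij[OF f(1) g(1)] f(1) g(1) by (simp add: BijGroup_def Diff_def)
  qed
qed

lemma group_Diff: "group (Diff r a b)"
proof -
  have "(BijGroup {a..b})\<lparr>carrier := carrier (Diff r a b)\<rparr> = Diff r a b"
    by (simp add: Diff_def)
  then show ?thesis
    using subgroup.subgroup_is_group[OF subgroup_Diff group_BijGroup] by metis
qed

end

theory Submission
  imports Defs "HOL-Analysis.Analysis" "HOL-Real_Asymp.Real_Asymp"
begin

text \<open>Identify the interior of the interval with the line by \<open>t = tan x\<close>; translations and dilations of
  the line then become smooth up to the endpoints, and a diffeomorphism of the line at bounded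
  distance from the identity becomes \<open>C\<^sup>1\<close> up to the endpoints as soon as its derivative tends to \<open>1\<close>.
  Let \<open>T\<close> be the translation by \<open>2\<pi>\<close> and let \<open>h\<close> be the time-one map \<open>b\<close> of a flow supported in an
  interval of length \<open>\<pi>\<close>, times the inverse of \<open>b\<close> translated by \<open>\<pi>\<close>. The diffeomorphism is
  \<open>f = T\<^sup>-\<^sup>1 h\<close>, so \<open>f\<^sup>n\<close> is \<open>T\<^sup>-\<^sup>n\<close> times the product of \<open>n\<close> disjoint translates of \<open>h\<close>.

  Hence the total variation of \<open>log Df\<^sup>n\<close> grows linearly; this variation is subadditive on \<open>C\<^sup>2\<close>
  diffeomorphisms, so \<open>f\<close> is undistorted there.

  In class \<open>C\<^sup>1\<close>, \<open>T\<^sup>n\<close> has length \<open>O(log n)\<close> thanks to the dilation by \<open>2\<close>. Let \<open>m\<close> tend to infinity slowly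
  and let the ladder \<open>A\<close> act on the \<open>i\<close>-th window, \<open>i \<ge> 0\<close>, as the flow at time \<open>1 / m i\<close>; it is \<open>C\<^sup>1\<close> because
  these times tend to \<open>0\<close>. The commutator of \<open>A\<close> with a map that is the identity left of the \<open>p\<close>-th
  window and the translation by \<open>\<pi>\<close> to the right of it is \<open>h\<close> at time \<open>1 / m i\<close> on all windows \<open>i \<ge> p\<close>. The quotient of
  two of these is supported on finitely many windows, and \<open>m n\<close> such quotients add up to \<open>h\<close> on
  each of the first \<open>n\<close> windows.\<close>


subsection \<open>Calculus of functions of class \<open>C\<^sup>k\<close>\<close>

lemma Ck_on_subset: "Ck_on k T f \<Longrightarrow> S \<subseteq> T \<Longrightarrow> Ck_on k S f"
proof (induction k arbitrary: f)
  case 0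
  then show ?case by (auto intro: continuous_on_subset)
next
  case (Suc k)
  then show ?case by (auto intro: DERIV_subset) (meson DERIV_subset Suc.IH subsetD)
qed

lemma Ck_on_SucI:
  "(\<And>x. x \<in> S \<Longrightarrow> (f has_real_derivative f' x) (at x within S)) \<Longrightarrow> Ck_on k S f' \<Longrightarrow> Ck_on (Suc k) S f"
  by auto

text \<open>Unlike in \<open>Ck_on_compose\<close>, the two sets may differ: charts such as
  \<open>tan\<close> map an open interval to the whole line.\<close>

lemma Ck_on_comp:
  assumes "f ` S \<subseteq> T"
  shows "Ck_on k T g \<Longrightarrow> Ck_on k S f \<Longrightarrow> Ck_on k S (\<lambda>x. g (f x))"
proof (induction k arbitrary: g)
  case 0
  then show ?case using assms by (auto intro: continuous_on_compose2)
next
  case (Suc k)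
  then obtain f' g' where d:
    "\<forall>x\<in>S. (f has_real_derivative f' x) (at x within S)" "Ck_on k S f'"
    "\<forall>x\<in>T. (g has_real_derivative g' x) (at x within T)" "Ck_on k T g'" by auto
  have "((\<lambda>x. g (f x)) has_real_derivative g' (f x) * f' x) (at x within S)" if "x \<in> S" for x
  proof -
    have "(g has_real_derivative g' (f x)) (at (f x) within f ` S)"
      using d assms that by (blast intro: DERIV_subset)
    then show ?thesis
      using DERIV_image_chain[of g "g' (f x)" f x S "f' x"] d(1) that by (simp add: o_def)
  qed
  moreover have "Ck_on k S (\<lambda>x. g' (f x) * f' x)"
    using Ck_on_mult[OF Suc.IH[OF d(4) Ck_on_Suc_imp[OF Suc.prems(2)]] d(2)] .
  ultimately show ?case by (rule Ck_on_SucI)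
qed

lemma Ck_on_minus: "Ck_on k S f \<Longrightarrow> Ck_on k S (\<lambda>x. - f x)"
  using Ck_on_mult[OF Ck_on_const[of k S "-1"], of f] by simp

lemma Ck_on_diff: "Ck_on k S f \<Longrightarrow> Ck_on k S g \<Longrightarrow> Ck_on k S (\<lambda>x. f x - g x)"
  using Ck_on_add[OF _ Ck_on_minus, of k S f g] by simp

lemma Ck_on_power: "Ck_on k S f \<Longrightarrow> Ck_on k S (\<lambda>x. f x ^ n)"
  by (induction n) (auto intro: Ck_on_const Ck_on_mult)

lemma Ck_on_id_inverse: "Ck_on k (- {0}) inverse"
proof (induction k)
  case (Suc k)
  have "Ck_on k (- {0}) (\<lambda>x. - (inverse x * inverse x))"
    by (intro Ck_on_minus Ck_on_mult Suc.IH)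
  moreover have "(inverse has_real_derivative - (inverse x * inverse x)) (at x within - {0})"
    if "x \<in> - {0}" for x :: real
    using that DERIV_inverse[of x "- {0}"] by (simp add: power2_eq_square)
  ultimately show ?case by (intro Ck_on_SucI)
qed (auto intro!: continuous_intros)

lemma Ck_on_inverse: "Ck_on k S f \<Longrightarrow> (\<And>x. x \<in> S \<Longrightarrow> f x \<noteq> 0) \<Longrightarrow> Ck_on k S (\<lambda>x. inverse (f x))"
  by (rule Ck_on_comp[OF _ Ck_on_id_inverse]) auto

lemma Ck_on_divide:
  "Ck_on k S f \<Longrightarrow> Ck_on k S g \<Longrightarrow> (\<And>x. x \<in> S \<Longrightarrow> g x \<noteq> 0) \<Longrightarrow> Ck_on k S (\<lambda>x. f x / g x)"
  unfolding divide_inverse by (intro Ck_on_mult Ck_on_inverse) auto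

lemma Ck_on_id_exp: "Ck_on k UNIV exp"
  by (induction k) (auto intro!: continuous_intros exI[of _ exp])

lemma Ck_on_exp: "Ck_on k S f \<Longrightarrow> Ck_on k S (\<lambda>x. exp (f x))"
  by (rule Ck_on_comp[OF _ Ck_on_id_exp]) auto

lemma Ck_on_id_ln: "Ck_on k {0<..} ln"
proof (cases k)
  case (Suc m)
  have "(ln has_real_derivative inverse x) (at x within {0<..})" if "x \<in> {0<..}" for x :: real
    using that by (auto intro!: derivative_eq_intros simp: divide_inverse)
  with Suc show ?thesis
    by (auto intro!: Ck_on_SucI[of _ _ inverse] Ck_on_subset[OF Ck_on_id_inverse] simp del: Ck_on.simps)
qed (auto intro!: continuous_intros)

lemma Ck_on_ln: "Ck_on k S f \<Longrightarrow> (\<And>x. x \<in> S \<Longrightarrow> f x > 0) \<Longrightarrow> Ck_on k S (\<lambda>x. ln (f x))"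
  by (rule Ck_on_comp[OF _ Ck_on_id_ln]) auto

lemma Ck_on_id_sqrt: "Ck_on k {0<..} sqrt"
proof (induction k)
  case (Suc k)
  have "Ck_on k {0<..} (\<lambda>x. inverse (sqrt x) * (1/2))"
    by (intro Ck_on_mult Ck_on_const Ck_on_inverse Suc.IH) auto
  moreover have "(sqrt has_real_derivative inverse (sqrt x) * (1/2)) (at x within {0<..})"
    if "x \<in> {0<..}" for x :: real
    using that by (auto intro!: derivative_eq_intros simp: field_simps)
  ultimately show ?case by (intro Ck_on_SucI)
qed (auto intro!: continuous_intros)

lemma Ck_on_sqrt: "Ck_on k S f \<Longrightarrow> (\<And>x. x \<in> S \<Longrightarrow> f x > 0) \<Longrightarrow> Ck_on k S (\<lambda>x. sqrt (f x))"
  by (rule Ck_on_comp[OF _ Ck_on_id_sqrt]) auto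

lemma Ck_on_sin_cos: "Ck_on k S sin \<and> Ck_on k S cos"
proof (induction k)
  case (Suc k)
  have "Ck_on (Suc k) S sin"
    using Suc.IH by (intro Ck_on_SucI[of _ _ cos]) (auto intro!: derivative_eq_intros)
  moreover have "Ck_on (Suc k) S cos"
    using Suc.IH by (intro Ck_on_SucI[of _ _ "\<lambda>x. - sin x"] Ck_on_minus) (auto intro!: derivative_eq_intros)
  ultimately show ?case by blast
qed (auto intro!: continuous_intros)

lemmas Ck_on_sin = Ck_on_sin_cos[THEN conjunct1]
  and Ck_on_cos = Ck_on_sin_cos[THEN conjunct2]

lemma Ck_on_id_arctan: "Ck_on k UNIV arctan"
proof (cases k)
  case (Suc m)
  have "Ck_on m UNIV (\<lambda>x::real. inverse (1 + x\<^sup>2))"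
    by (intro Ck_on_inverse Ck_on_add Ck_on_const Ck_on_power Ck_on_ident)
      (smt (verit) zero_le_power2)
  moreover have "(arctan has_real_derivative inverse (1 + x\<^sup>2)) (at x within UNIV)" for x
    by (simp add: DERIV_arctan)
  ultimately show ?thesis unfolding Suc by (intro Ck_on_SucI) 
qed (auto intro!: continuous_intros)

lemma Ck_on_arctan: "Ck_on k S f \<Longrightarrow> Ck_on k S (\<lambda>x. arctan (f x))"
  by (rule Ck_on_comp[OF _ Ck_on_id_arctan]) auto

lemma Ck_on_tan: "Ck_on k {-(pi/2)<..<pi/2} tan"
  unfolding tan_def by (intro Ck_on_divide Ck_on_sin Ck_on_cos) (auto dest: cos_gt_zero_pi)

lemma Ck_on_sinh: "Ck_on k S f \<Longrightarrow> Ck_on k S (\<lambda>x. sinh (f x))"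
  unfolding sinh_field_def
  by (intro Ck_on_divide Ck_on_diff Ck_on_exp Ck_on_minus Ck_on_const) auto

lemma Ck_on_arsinh: "Ck_on k S f \<Longrightarrow> Ck_on k S (\<lambda>x. arsinh (f x))"
  unfolding arsinh_real_def
  by (intro Ck_on_ln Ck_on_add Ck_on_sqrt Ck_on_power Ck_on_const arsinh_real_aux)
    (auto intro: add_nonneg_pos)

text \<open>On an open set derivatives within the set are two-sided, so the unspecified witness in
  \<open>Ck_on\<close> must be \<open>deriv f\<close>.\<close>

lemma Ck_on_open_deriv:
  assumes "open U" "Ck_on (Suc k) U f"
  shows "(\<forall>x\<in>U. (f has_real_derivative deriv f x) (at x)) \<and> Ck_on k U (deriv f)"
proof -
  obtain f' where f': "\<forall>x\<in>U. (f has_real_derivative f' x) (at x within U)" "Ck_on k U f'"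
    using assms by auto
  have d: "(f has_real_derivative f' x) (at x)" if "x \<in> U" for x
    using f'(1) that at_within_open[OF that assms(1)] by auto
  then have "deriv f x = f' x" if "x \<in> U" for x using that by (simp add: DERIV_imp_deriv)
  then show ?thesis using d f'(2) by (metis Ck_on_cong)
qed

text \<open>Derivatives found on different neighbourhoods glue because \<open>deriv f\<close> is a
  choice independent of the neighbourhood.\<close>

lemma Ck_on_local:
  assumes "\<And>x. x \<in> S \<Longrightarrow> \<exists>U. open U \<and> x \<in> U \<and> Ck_on k U f"
  shows "Ck_on k S f"
  using assms
proof (induction k arbitrary: f)
  case 0
  have "isCont f x" if "x \<in> S" for x
    using 0[OF that] by (auto simp: continuous_on_eq_continuous_at)
  then show ?case by (auto intro: continuous_at_imp_continuous_on)
next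
  case (Suc k)
  have *: "\<exists>U. open U \<and> x \<in> U \<and> (f has_real_derivative deriv f x) (at x) \<and> Ck_on k U (deriv f)"
    if "x \<in> S" for x
    using Suc.prems[OF that] Ck_on_open_deriv[of _ k f] by blast
  then have "(f has_real_derivative deriv f x) (at x within S)" if "x \<in> S" for x
    using that has_field_derivative_at_within by blast
  moreover have "Ck_on k S (deriv f)" using * by (intro Suc.IH) blast
  ultimately show ?case by (rule Ck_on_SucI)
qed

section \<open>Regularity of the inverse map\<close>

lemma continuous_on_inv_into_bij:
  fixes f :: "real \<Rightarrow> real"
  assumes bij: "bij_betw f {a..b} {a..b}" and cont: "continuous_on {a..b} f"
  shows "continuous_on {a..b} (inv_into {a..b} f)"
proof (rule continuous_on_eq)
  show "continuous_on {a..b} (the_inv_into {a..b} f)"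
    using continuous_on_inv_into[OF cont] bij by (simp add: bij_betw_def)
  show "the_inv_into {a..b} f x = inv_into {a..b} f x" if "x \<in> {a..b}" for x
    using bij that the_inv_into_f_f[of f "{a..b}" "inv_into {a..b} f x"]
    by (auto simp: bij_betw_def f_inv_into_f inv_into_into simp del: atLeastAtMost_iff)
qed

text \<open>The difference quotient of the inverse is the reciprocal of that of \<open>f\<close>;
  continuity and injectivity of the inverse justify the change of variable, also at the
  endpoints.\<close>

lemma inv_into_has_real_derivative:
  assumes bij: "bij_betw f {a..b} {a..b}" and cont: "continuous_on {a..b} f"
    and der: "(f has_real_derivative d) (at (inv_into {a..b} f y) within {a..b})" "d \<noteq> 0"
    and y: "y \<in> {a..b}"
  shows "(inv_into {a..b} f has_real_derivative inverse d) (at y within {a..b})"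
proof -
  let ?g = "inv_into {a..b} f"
  have gI: "?g z \<in> {a..b}" and fg: "f (?g z) = z" if "z \<in> {a..b}" for z
    using bij that by (auto simp: bij_betw_def f_inv_into_f inv_into_into simp del: atLeastAtMost_iff)
  have gc: "continuous_on {a..b} ?g" by (rule continuous_on_inv_into_bij[OF bij cont])
  have lim: "((\<lambda>z. (f z - f (?g y)) / (z - ?g y)) \<longlongrightarrow> d) (at (?g y) within {a..b})"
    using der(1) by (simp add: has_field_derivative_iff)
  have "filterlim ?g (at (?g y) within {a..b}) (at y within {a..b})"
    unfolding filterlim_at
  proof
    show "(?g \<longlongrightarrow> ?g y) (at y within {a..b})" using gc y by (auto simp: continuous_on_def)
    have "?g z \<noteq> ?g y" if "z \<in> {a..b}" "z \<noteq> y" for z using that y fg by metis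
    then show "\<forall>\<^sub>F x in at y within {a..b}. ?g x \<in> {a..b} \<and> ?g x \<noteq> ?g y"
      using gI by (auto simp: eventually_at_filter simp del: atLeastAtMost_iff)
  qed
  from filterlim_compose[OF lim this]
  have "((\<lambda>z. (f (?g z) - f (?g y)) / (?g z - ?g y)) \<longlongrightarrow> d) (at y within {a..b})" .
  from tendsto_inverse[OF this der(2)]
  have "((\<lambda>z. (?g z - ?g y) / (f (?g z) - f (?g y))) \<longlongrightarrow> inverse d) (at y within {a..b})"
    by simp
  then have "((\<lambda>z. (?g z - ?g y) / (z - y)) \<longlongrightarrow> inverse d) (at y within {a..b})"
  proof (rule Lim_transform_eventually)
    show "\<forall>\<^sub>F z in at y within {a..b}. (?g z - ?g y) / (f (?g z) - f (?g y)) = (?g z - ?g y) / (z - y)"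
      using fg y by (simp add: eventually_at_filter del: atLeastAtMost_iff)
  qed
  then show ?thesis by (simp add: has_field_derivative_iff)
qed

text \<open>Bootstrap: the inverse \<open>g\<close> has derivative 1 / f'(g), so regularity of
  \<open>g\<close> of one order yields the next. The disjunction in the premise asks nothing of
  \<open>f'\<close> at \<open>k = 0\<close>, where \<open>k - 1\<close> would be truncated.\<close>

lemma Ck_on_inv_into:
  assumes bij: "bij_betw f {a..b} {a..b}"
    and der: "\<And>x. x \<in> {a..b} \<Longrightarrow> (f has_real_derivative f' x) (at x within {a..b})"
    and nz: "\<And>x. x \<in> {a..b} \<Longrightarrow> f' x \<noteq> 0"
  shows "k = 0 \<or> Ck_on (k - 1) {a..b} f' \<Longrightarrow> Ck_on k {a..b} (inv_into {a..b} f)"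
proof (induction k)
  case 0
  have "continuous_on {a..b} f" using der by (rule DERIV_continuous_on)
  then show ?case using continuous_on_inv_into_bij[OF bij] by simp
next
  case (Suc k)
  let ?g = "inv_into {a..b} f"
  have gI: "?g z \<in> {a..b}" if "z \<in> {a..b}" for z
    using bij that by (auto simp: bij_betw_def inv_into_into simp del: atLeastAtMost_iff)
  have f': "Ck_on k {a..b} f'" using Suc.prems by simp
  have "Ck_on k {a..b} ?g"
  proof (rule Suc.IH)
    show "k = 0 \<or> Ck_on (k - 1) {a..b} f'"
      using f' Ck_on_Suc_imp[of "k - 1" "{a..b}" f'] by (cases k) simp_all
  qed
  then have "Ck_on k {a..b} (\<lambda>y. inverse (f' (?g y)))"
    using gI nz by (intro Ck_on_inverse Ck_on_comp[OF _ f']) blast+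
  moreover have "(?g has_real_derivative inverse (f' (?g y))) (at y within {a..b})"
    if "y \<in> {a..b}" for y
    using that gI[OF that] der nz bij DERIV_continuous_on[OF der]
    by (intro inv_into_has_real_derivative) blast+
  ultimately show ?case by (intro Ck_on_SucI)
qed

lemma Diff_memI:
  assumes bij: "f \<in> Bij {a..b}" and mono: "strict_mono_on {a..b} f"
    and der: "\<And>x. x \<in> {a..b} \<Longrightarrow> (f has_real_derivative f' x) (at x within {a..b})"
    and nz: "\<And>x. x \<in> {a..b} \<Longrightarrow> f' x \<noteq> 0"
    and Ck: "\<And>k. enat (Suc k) \<le> r \<Longrightarrow> Ck_on k {a..b} f'"
  shows "f \<in> carrier (Diff r a b)"
proof -
  have "Ck_on k {a..b} f \<and> Ck_on k {a..b} (inv_into {a..b} f)" if "enat k \<le> r" for k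
  proof (cases k)
    case 0
    have "continuous_on {a..b} f" using der by (rule DERIV_continuous_on)
    moreover have "Ck_on 0 {a..b} (inv_into {a..b} f)"
      using bij by (intro Ck_on_inv_into[OF _ der nz]) (auto simp: Bij_def)
    ultimately show ?thesis using 0 by simp
  next
    case (Suc m)
    then have m: "Ck_on m {a..b} f'" using Ck that by simp
    then have "Ck_on k {a..b} f" unfolding Suc using der by (intro Ck_on_SucI)
    moreover have "Ck_on k {a..b} (inv_into {a..b} f)"
      using bij m Suc by (intro Ck_on_inv_into[OF _ der nz]) (auto simp: Bij_def)
    ultimately show ?thesis by simp
  qed
  then show ?thesis using bij mono by (auto simp: Diff_def C_on_def)
qed


subsection \<open>Diffeomorphisms of the line in the chart \<open>tan\<close>\<close>

abbreviation J :: "real set" where "J \<equiv> {-(pi/2)..pi/2}"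

text \<open>\<open>tan\<close> takes the default value 0 at both endpoints, so these are fixed by a
  separate clause.\<close>

definition lift :: "(real \<Rightarrow> real) \<Rightarrow> real \<Rightarrow> real" where
  "lift F = (\<lambda>x\<in>J. if \<bar>x\<bar> = pi/2 then x else arctan (F (tan x)))"

lemma lift_interior: "\<bar>x\<bar> < pi/2 \<Longrightarrow> lift F x = arctan (F (tan x))"
  by (auto simp: lift_def)

lemma lift_ends: "\<bar>x\<bar> = pi/2 \<Longrightarrow> lift F x = x"
  by (auto simp: lift_def)

lemma abs_arctan_less: "\<bar>arctan t\<bar> < pi/2"
  using arctan_bounded[of t] by auto

lemma lift_arctan: "lift F (arctan t) = arctan (F t)"
  using lift_interior[OF abs_arctan_less, of F t] by (simp add: tan_arctan)

lemma arctan_mem_J: "arctan t \<in> J"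
  using arctan_bounded[of t] by auto

lemma J_cases:
  assumes "x \<in> J" obtains "\<bar>x\<bar> = pi/2" | t where "x = arctan t"
proof (cases "\<bar>x\<bar> = pi/2")
  case False
  then have "-(pi/2) < x" "x < pi/2" using assms unfolding atLeastAtMost_iff by linarith+
  then have "x = arctan (tan x)" by (simp add: arctan_tan)
  then show ?thesis using that by blast
qed (use that in blast)

lemma lift_mem:
  assumes "x \<in> J" shows "lift F x \<in> J"
  using assms
proof (cases rule: J_cases)
  case 1
  then show ?thesis using assms lift_ends by metis
next
  case (2 t)
  then show ?thesis using lift_arctan arctan_mem_J by metis
qed

lemma lift_comp: "compose J (lift F) (lift G) = lift (F \<circ> G)"
proof (rule ext)
  fix x show "compose J (lift F) (lift G) x = lift (F \<circ> G) x"
  proof (cases "x \<in> J")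
    case True
    then show ?thesis using True
      by (cases rule: J_cases) (simp_all add: compose_def lift_ends lift_arctan
          del: atLeastAtMost_iff)
  qed (simp add: compose_def lift_def del: atLeastAtMost_iff)
qed

lemma lift_id: "lift id = (\<lambda>x\<in>J. x)"
proof (rule ext)
  fix x show "lift id x = (\<lambda>x\<in>J. x) x"
  proof (cases "x \<in> J")
    case True
    then show ?thesis using True
      by (cases rule: J_cases) (simp_all add: lift_ends lift_arctan
          del: atLeastAtMost_iff)
  qed (simp add: lift_def del: atLeastAtMost_iff)
qed

text \<open>\<open>lift\<close> respects composition and the identity, so the lift of the inverse
  inverts the lift.\<close>

lemma lift_Bij:
  assumes "bij F" shows "lift F \<in> Bij J"
proof -
  have inverse: "lift G (lift F x) = x" if "x \<in> J" "G \<circ> F = id" for x F G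
  proof -
    have "compose J (lift G) (lift F) x = x" using that by (simp add: lift_comp lift_id del: atLeastAtMost_iff)
    then show ?thesis using that(1) by (simp add: compose_def del: atLeastAtMost_iff)
  qed
  have "F \<circ> inv_into UNIV F = id" "inv_into UNIV F \<circ> F = id"
    using assms by (auto simp: bij_def surj_iff inj_iff)
  then have "bij_betw (lift F) J J"
    using lift_mem by (intro bij_betw_byWitness[of J "lift (inv_into UNIV F)"]) (auto simp: inverse simp del: atLeastAtMost_iff)
  then show ?thesis by (auto simp: Bij_def lift_def)
qed

lemma lift_strict_mono:
  assumes "strict_mono F" shows "strict_mono_on J (lift F)"
proof (rule strict_mono_onI)
  fix x y assume "x \<in> J" "y \<in> J" "x < y"
  then consider "\<bar>x\<bar> = pi/2" "\<bar>y\<bar> = pi/2" | t where "\<bar>x\<bar> = pi/2" "y = arctan t"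
    | s where "x = arctan s" "\<bar>y\<bar> = pi/2" | s t where "x = arctan s" "y = arctan t"
    by (metis J_cases)
  then show "lift F x < lift F y"
  proof cases
    case (2 t)
    then have "x = - (pi/2)" using \<open>x < y\<close> arctan_bounded[of t] by auto
    then show ?thesis using 2 arctan_bounded[of "F t"] by (simp add: lift_ends lift_arctan)
  next
    case (3 s)
    then have "y = pi/2" using \<open>x < y\<close> arctan_bounded[of s] by auto
    then show ?thesis using 3 arctan_bounded[of "F s"] by (simp add: lift_ends lift_arctan)
  next
    case (4 s t)
    then show ?thesis using \<open>x < y\<close> assms by (simp add: lift_arctan arctan_less_iff strict_mono_less)
  qed (use \<open>x < y\<close> in \<open>auto simp: lift_ends\<close>)
qed

text \<open>The limits \<open>l\<close> and \<open>u\<close> are the one-sided derivatives of \<^term>\<open>lift F\<close> at the two endpoints.\<close>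

definition chart_C1 :: "(real \<Rightarrow> real) \<Rightarrow> (real \<Rightarrow> real) \<Rightarrow> real \<Rightarrow> real \<Rightarrow> bool" where
  "chart_C1 F F' l u \<longleftrightarrow> surj F \<and> (\<forall>t. (F has_real_derivative F' t) (at t) \<and> isCont F' t \<and> F' t > 0) \<and>
     ((\<lambda>t. F' t * (1 + t\<^sup>2) / (1 + (F t)\<^sup>2)) \<longlongrightarrow> l) at_bot \<and>
     ((\<lambda>t. F' t * (1 + t\<^sup>2) / (1 + (F t)\<^sup>2)) \<longlongrightarrow> u) at_top \<and> l > 0 \<and> u > 0"

text \<open>Inside the interval this is the chain rule for \<open>arctan (F (tan x))\<close>, as the
  derivative of \<open>tan\<close> is 1 + tan^2.\<close>

definition lift_deriv :: "(real \<Rightarrow> real) \<Rightarrow> (real \<Rightarrow> real) \<Rightarrow> real \<Rightarrow> real \<Rightarrow> real \<Rightarrow> real" where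
  "lift_deriv F F' l u x = (if x \<le> -(pi/2) then l else if x \<ge> pi/2 then u else
     F' (tan x) * (1 + (tan x)\<^sup>2) / (1 + (F (tan x))\<^sup>2))"

lemma strict_mono_of_deriv_pos:
  assumes "\<And>t. (F has_real_derivative F' t) (at t)" "\<And>t. F' t > (0::real)"
  shows "strict_mono F"
  by (rule strict_monoI) (use assms DERIV_pos_imp_increasing in blast)

lemma chart_C1_bij: "chart_C1 F F' l u \<Longrightarrow> strict_mono F \<and> bij F"
  using strict_mono_of_deriv_pos[of F F'] by (auto simp: chart_C1_def bij_def intro: strict_mono_imp_inj_on)

lemma lift_has_deriv_interior:
  assumes "(F has_real_derivative d) (at (tan x))" "\<bar>x\<bar> < pi/2"
  shows "(lift F has_real_derivative d * (1 + (tan x)\<^sup>2) / (1 + (F (tan x))\<^sup>2)) (at x)"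
proof -
  have c: "cos x > 0" using assms(2) by (auto intro: cos_gt_zero_pi)
  then have sec: "inverse ((cos x)\<^sup>2) = 1 + (tan x)\<^sup>2"
    using tan_sec[of x] by (simp add: power_inverse)
  have "((\<lambda>x. arctan (F (tan x))) has_real_derivative
      inverse (1 + (F (tan x))\<^sup>2) * (d * inverse ((cos x)\<^sup>2))) (at x)"
    using c assms(1) by (intro DERIV_chain2[OF DERIV_arctan] DERIV_chain2[of F d tan] DERIV_tan) auto
  then have "((\<lambda>x. arctan (F (tan x))) has_real_derivative
      d * (1 + (tan x)\<^sup>2) / (1 + (F (tan x))\<^sup>2)) (at x)"
    unfolding sec by (simp add: divide_inverse ac_simps)
  then show ?thesis
    by (rule has_field_derivative_transform_within_open[where S = "{-(pi/2)<..<pi/2}"])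
      (use assms(2) in \<open>auto simp: lift_interior abs_less_iff\<close>)
qed

lemma filterlim_at_top_of_mono_surj:
  fixes F :: "real \<Rightarrow> real"
  assumes "strict_mono F" "surj F"
  shows "filterlim F at_top at_top" "filterlim F at_bot at_bot"
proof -
  show "filterlim F at_top at_top"
    unfolding filterlim_at_top
  proof
    fix Z obtain t where "F t = Z" using assms(2) by (metis surjD)
    then show "\<forall>\<^sub>F x in at_top. Z \<le> F x"
      using eventually_ge_at_top[of t] assms(1) by (auto elim!: eventually_mono simp: strict_mono_less_eq)
  qed
  show "filterlim F at_bot at_bot"
    unfolding filterlim_at_bot
  proof
    fix Z obtain t where "F t = Z" using assms(2) by (metis surjD)
    then show "\<forall>\<^sub>F x in at_bot. F x \<le> Z"
      using eventually_le_at_bot[of t] assms(1) by (auto elim!: eventually_mono simp: strict_mono_less_eq)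
  qed
qed

lemma eventually_interior:
  "\<forall>\<^sub>F x in at_left (pi/2). \<bar>x\<bar> < pi/2" "\<forall>\<^sub>F x in at_right (-(pi/2)). \<bar>x\<bar> < pi/2"
proof -
  have "\<forall>\<^sub>F x in at_left (pi/2). x \<in> {-(pi/2)<..<pi/2}"
    by (rule eventually_at_left_real) simp
  then show "\<forall>\<^sub>F x in at_left (pi/2). \<bar>x\<bar> < pi/2" by eventually_elim auto
  have "\<forall>\<^sub>F x in at_right (-(pi/2)). x \<in> {-(pi/2)<..<pi/2}"
    by (rule eventually_at_right_real) simp
  then show "\<forall>\<^sub>F x in at_right (-(pi/2)). \<bar>x\<bar> < pi/2" by eventually_elim auto
qed

lemma lift_deriv_tendsto:
  assumes "chart_C1 F F' l u"
  shows "(lift_deriv F F' l u \<longlongrightarrow> l) (at_right (-(pi/2)))"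
    and "(lift_deriv F F' l u \<longlongrightarrow> u) (at_left (pi/2))"
proof -
  let ?R = "\<lambda>t. F' t * (1 + t\<^sup>2) / (1 + (F t)\<^sup>2)"
  have "((\<lambda>x. ?R (tan x)) \<longlongrightarrow> l) (at_right (-(pi/2)))"
    using assms by (intro filterlim_compose[OF _ filterlim_tan_at_right]) (simp add: chart_C1_def)
  then show "(lift_deriv F F' l u \<longlongrightarrow> l) (at_right (-(pi/2)))"
    by (rule Lim_transform_eventually)
      (use eventually_interior(2) in \<open>eventually_elim, auto simp: lift_deriv_def\<close>)
  have "((\<lambda>x. ?R (tan x)) \<longlongrightarrow> u) (at_left (pi/2))"
    using assms by (intro filterlim_compose[OF _ filterlim_tan_at_left]) (simp add: chart_C1_def)
  then show "(lift_deriv F F' l u \<longlongrightarrow> u) (at_left (pi/2))"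
    by (rule Lim_transform_eventually)
      (use eventually_interior(1) in \<open>eventually_elim, auto simp: lift_deriv_def\<close>)
qed

lemma lift_has_deriv:
  assumes F: "chart_C1 F F' l u" and x: "x \<in> J"
  shows "(lift F has_real_derivative lift_deriv F F' l u x) (at x within J)"
proof -
  let ?E = "lift_deriv F F' l u"
  have [simp]: "\<not> pi \<le> 0" using pi_gt_zero by linarith
  have int: "(lift F has_real_derivative ?E x) (at x)" if "\<bar>x\<bar> < pi/2" for x
  proof -
    have "\<not> x \<le> -(pi/2)" "\<not> pi/2 \<le> x" using that by linarith+
    then have "?E x = F' (tan x) * (1 + (tan x)\<^sup>2) / (1 + (F (tan x))\<^sup>2)"
      unfolding lift_deriv_def by (simp only: if_False)
    then show ?thesis
      using lift_has_deriv_interior[OF _ that, of F "F' (tan x)"] F by (simp only: chart_C1_def)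
  qed
  have lims: "filterlim F at_top at_top" "filterlim F at_bot at_bot"
    using filterlim_at_top_of_mono_surj[of F] chart_C1_bij[OF F] by (auto simp: bij_def)
  consider "x = pi/2" | "x = -(pi/2)" | "\<bar>x\<bar> < pi/2" using x by fastforce
  then show ?thesis
  proof cases
    case 1
    have "((\<lambda>x. arctan (F (tan x))) \<longlongrightarrow> pi/2) (at_left (pi/2))"
      by (intro filterlim_compose[OF tendsto_arctan_at_top] filterlim_compose[OF lims(1)] filterlim_tan_at_left)
    then have "(lift F \<longlongrightarrow> pi/2) (at_left (pi/2))"
      by (rule Lim_transform_eventually)
        (use eventually_interior(1) in \<open>eventually_elim, auto simp: lift_interior\<close>)
    then have f0: "((\<lambda>x. lift F x - pi/2) \<longlongrightarrow> 0) (at_left (pi/2))"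
      by (simp add: LIM_zero)
    have "((\<lambda>x. (lift F x - pi/2) / (x - pi/2)) \<longlongrightarrow> u) (at_left (pi/2))"
    proof (rule lhopital_left[OF f0, where f' = ?E and g' = "\<lambda>_. 1"])
      show "((\<lambda>x. x - pi/2) \<longlongrightarrow> 0) (at_left (pi/2))"
        by (intro LIM_zero tendsto_ident_at)
      show "\<forall>\<^sub>F x in at_left (pi / 2). x - pi / 2 \<noteq> 0"
        using eventually_interior(1) by eventually_elim auto
      show "\<forall>\<^sub>F x in at_left (pi / 2). ((\<lambda>x. lift F x - pi / 2) has_real_derivative ?E x) (at x)"
        using eventually_interior(1) by eventually_elim (use int in \<open>auto intro!: derivative_eq_intros\<close>)
    qed (use lift_deriv_tendsto(2)[OF F] in \<open>auto intro!: derivative_eq_intros always_eventually\<close>)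
    then show ?thesis
      unfolding 1 by (simp add: has_field_derivative_iff at_within_Icc_at_left lift_ends lift_deriv_def)
  next
    case 2
    have "((\<lambda>x. arctan (F (tan x))) \<longlongrightarrow> -(pi/2)) (at_right (-(pi/2)))"
      by (intro filterlim_compose[OF tendsto_arctan_at_bot] filterlim_compose[OF lims(2)] filterlim_tan_at_right)
    then have "(lift F \<longlongrightarrow> -(pi/2)) (at_right (-(pi/2)))"
      by (rule Lim_transform_eventually)
        (use eventually_interior(2) in \<open>eventually_elim, auto simp: lift_interior\<close>)
    then have f0: "((\<lambda>x. lift F x - (-(pi/2))) \<longlongrightarrow> 0) (at_right (-(pi/2)))"
      by (rule LIM_zero)
    have "((\<lambda>x. (lift F x - (-(pi/2))) / (x - (-(pi/2)))) \<longlongrightarrow> l) (at_right (-(pi/2)))"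
    proof (rule lhopital_right[OF f0, where f' = ?E and g' = "\<lambda>_. 1"])
      show "((\<lambda>x. x - (-(pi/2))) \<longlongrightarrow> 0) (at_right (-(pi/2)))"
        by (intro LIM_zero tendsto_ident_at)
      show "\<forall>\<^sub>F x in at_right (-(pi/2)). x - (-(pi/2)) \<noteq> 0"
        using eventually_interior(2) by eventually_elim auto
      show "\<forall>\<^sub>F x in at_right (-(pi/2)). ((\<lambda>x. lift F x - (-(pi/2))) has_real_derivative ?E x) (at x)"
        using eventually_interior(2) by eventually_elim (use int in \<open>auto intro!: derivative_eq_intros\<close>)
    qed (use lift_deriv_tendsto(1)[OF F] in \<open>auto intro!: derivative_eq_intros always_eventually\<close>)
    then show ?thesis
      unfolding 2 by (simp add: has_field_derivative_iff at_within_Icc_at_right lift_ends lift_deriv_def)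
  next
    case 3
    then show ?thesis using int has_field_derivative_at_within by blast
  qed
qed

lemma lift_deriv_continuous:
  assumes F: "chart_C1 F F' l u"
  shows "continuous_on J (lift_deriv F F' l u)"
  unfolding continuous_on_eq_continuous_within
proof
  let ?E = "lift_deriv F F' l u"
  have [simp]: "\<not> pi \<le> 0" using pi_gt_zero by linarith
  fix x assume x: "x \<in> J"
  consider "x = pi/2" | "x = -(pi/2)" | "\<bar>x\<bar> < pi/2" using x by fastforce
  then show "continuous (at x within J) ?E"
  proof cases
    case 1
    show ?thesis using lift_deriv_tendsto(2)[OF F] unfolding 1
      by (simp add: continuous_within at_within_Icc_at_left lift_deriv_def[of _ _ _ _ "pi/2"])
  next
    case 2
    show ?thesis using lift_deriv_tendsto(1)[OF F] unfolding 2
      by (simp add: continuous_within at_within_Icc_at_right lift_deriv_def[of _ _ _ _ "-(pi/2)"])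
  next
    case 3
    then have "cos x > 0" by (intro cos_gt_zero_pi) linarith+
    then have c: "cos x \<noteq> 0" by simp
    have "isCont F (tan x)" "isCont F' (tan x)"
      using F by (auto simp: chart_C1_def intro: DERIV_isCont)
    then have "isCont (\<lambda>x. F' (tan x) * (1 + (tan x)\<^sup>2) / (1 + (F (tan x))\<^sup>2)) x"
      using c by (intro continuous_intros isCont_o2[OF isCont_tan])
        (auto simp: add_nonneg_eq_0_iff)
    moreover have ev: "\<forall>\<^sub>F y in nhds x. F' (tan y) * (1 + (tan y)\<^sup>2) / (1 + (F (tan y))\<^sup>2) = ?E y"
    proof -
      have "\<forall>\<^sub>F y in nhds x. y \<in> {-(pi/2)<..<pi/2}"
        using 3 by (intro eventually_nhds_in_open) auto
      then show ?thesis by eventually_elim (auto simp: lift_deriv_def)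
    qed
    ultimately have "isCont ?E x" using isCont_cong[OF ev] by simp
    then show ?thesis by (rule continuous_at_imp_continuous_at_within)
  qed
qed

lemma lift_deriv_pos: "chart_C1 F F' l u \<Longrightarrow> lift_deriv F F' l u x > 0"
  by (auto simp: lift_deriv_def chart_C1_def intro!: divide_pos_pos mult_pos_pos add_pos_nonneg)

lemma lift_in_Diff1:
  assumes F: "chart_C1 F F' l u"
  shows "lift F \<in> carrier (Diff 1 (-(pi/2)) (pi/2))"
proof (rule Diff_memI[where f' = "lift_deriv F F' l u"])
  show "Ck_on k J (lift_deriv F F' l u)" if "enat (Suc k) \<le> 1" for k
    using that lift_deriv_continuous[OF F] by (simp add: one_enat_def)
qed (use chart_C1_bij[OF F] lift_Bij lift_strict_mono lift_has_deriv[OF F] lift_deriv_pos[OF F] in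
    \<open>auto simp: less_imp_neq[symmetric] simp del: atLeastAtMost_iff\<close>)

section \<open>Behaviour at infinity: bounded displacement, translations and dilations\<close>

text \<open>The reciprocal ratio minus 1 equals (F t - t) (2 t + (F t - t)) / (1 + t^2), which is
  O(1 / |t|).\<close>

lemma displacement_ratio_tendsto:
  fixes F :: "real \<Rightarrow> real"
  assumes bd: "\<And>t. \<bar>F t - t\<bar> \<le> C" and A: "A = at_top \<or> A = at_bot"
  shows "((\<lambda>t. (1 + t\<^sup>2) / (1 + (F t)\<^sup>2)) \<longlongrightarrow> 1) A"
proof -
  have "((\<lambda>t::real. (2 * C * \<bar>t\<bar> + C\<^sup>2) / (1 + t\<^sup>2)) \<longlongrightarrow> 0) A"
    using A by (elim disjE; simp; real_asymp)
  then have "((\<lambda>t. (1 + (F t)\<^sup>2) / (1 + t\<^sup>2) - 1) \<longlongrightarrow> 0) A"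
  proof (rule Lim_null_comparison[rotated])
    have "norm ((1 + (F t)\<^sup>2) / (1 + t\<^sup>2) - 1) \<le> (2 * C * \<bar>t\<bar> + C\<^sup>2) / (1 + t\<^sup>2)" for t
    proof -
      have p: "1 + t\<^sup>2 > 0" by (simp add: add_pos_nonneg)
      then have e: "(1 + (F t)\<^sup>2) / (1 + t\<^sup>2) - 1 = ((F t - t) * (2 * t + (F t - t))) / (1 + t\<^sup>2)"
        by (simp add: field_simps power2_eq_square)
      have "\<bar>(F t - t) * (2 * t + (F t - t))\<bar> \<le> C * (2 * \<bar>t\<bar> + C)"
        unfolding abs_mult using bd[of t] by (intro mult_mono) (auto simp: abs_if split: if_splits)
      then show ?thesis using p unfolding e by (simp add: divide_right_mono power2_eq_square algebra_simps)
    qed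
    then show "\<forall>\<^sub>F t in A. norm ((1 + (F t)\<^sup>2) / (1 + t\<^sup>2) - 1) \<le> (2 * C * \<bar>t\<bar> + C\<^sup>2) / (1 + t\<^sup>2)"
      by simp
  qed
  then have "((\<lambda>t. (1 + (F t)\<^sup>2) / (1 + t\<^sup>2)) \<longlongrightarrow> 1) A" by (rule LIM_zero_cancel)
  from tendsto_inverse[OF this] show ?thesis by simp
qed

lemma surj_of_bounded_displacement:
  fixes F :: "real \<Rightarrow> real"
  assumes "\<And>t. isCont F t" "\<And>t. \<bar>F t - t\<bar> \<le> C"
  shows "surj F"
proof -
  have "\<exists>x. F x = y" for y
  proof -
    have "F (y - C) \<le> y" "y \<le> F (y + C)" "y - C \<le> y + C"
      using assms(2)[of "y - C"] assms(2)[of "y + C"] by linarith+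
    then show ?thesis using IVT[of F "y - C" y "y + C"] assms(1) by blast
  qed
  then show ?thesis by (metis surjI)
qed

lemma chart_C1_of_bounded_displacement:
  assumes der: "\<And>t. (F has_real_derivative F' t) (at t)" and cont: "\<And>t. isCont F' t"
    and pos: "\<And>t. F' t > 0" and bd: "\<And>t. \<bar>F t - t\<bar> \<le> C"
    and lim: "(F' \<longlongrightarrow> 1) at_bot" "(F' \<longlongrightarrow> 1) at_top"
  shows "chart_C1 F F' 1 1"
proof -
  have "((\<lambda>t. F' t * (1 + t\<^sup>2) / (1 + (F t)\<^sup>2)) \<longlongrightarrow> 1) A" if "A = at_top \<or> A = at_bot" for A
    using tendsto_mult[of F' 1 A, OF _ displacement_ratio_tendsto[OF bd that]] lim that by auto
  moreover have "surj F" using der bd by (intro surj_of_bounded_displacement) (auto intro: DERIV_isCont)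
  ultimately show ?thesis using assms by (simp add: chart_C1_def)
qed

lemma translation_chart_C1: "chart_C1 (\<lambda>t. t + c) (\<lambda>_. 1) 1 1"
  by (rule chart_C1_of_bounded_displacement[where C = "\<bar>c\<bar>"]) (auto intro!: derivative_eq_intros)

text \<open>The displacement is unbounded, and the chart factor tends to 1 / c^2; hence the endpoint
  derivatives c / c^2 = 1 / c.\<close>

lemma scaling_chart_C1:
  assumes "c > 0" shows "chart_C1 (\<lambda>t. c * t) (\<lambda>_. c) (1/c) (1/c)"
proof -
  have "surj (\<lambda>t. c * t)" using assms by (intro surjI[of _ "\<lambda>t. t / c"]) simp
  moreover have "c * inverse (c\<^sup>2) = 1/c" using assms by (simp add: field_simps power2_eq_square)
  moreover have "((\<lambda>t. c * (1 + t\<^sup>2) / (1 + (c * t)\<^sup>2)) \<longlongrightarrow> c * inverse (c\<^sup>2)) at_top"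
    "((\<lambda>t. c * (1 + t\<^sup>2) / (1 + (c * t)\<^sup>2)) \<longlongrightarrow> c * inverse (c\<^sup>2)) at_bot"
    using assms by real_asymp+
  ultimately show ?thesis
    using assms by (auto simp: chart_C1_def intro!: derivative_eq_intros)
qed

lemma translation_lift_Diff: "lift (\<lambda>t. t + c) \<in> carrier (Diff r (-(pi/2)) (pi/2))"
proof -
  let ?F = "\<lambda>t. t + c"
  \<comment> \<open>Multiplying numerator and denominator of the interior derivative by cos^2
    removes the poles of \<open>tan\<close>; the result is smooth through the endpoints.\<close>
  let ?E = "\<lambda>x. 1 / ((cos x)\<^sup>2 + (sin x + c * cos x)\<^sup>2)"
  have nz: "(cos x)\<^sup>2 + (sin x + c * cos x)\<^sup>2 \<noteq> 0" for x
    using sin_zero_abs_cos_one[of x] by (auto simp: sum_power2_eq_zero_iff)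
  have eq: "lift_deriv ?F (\<lambda>_. 1) 1 1 x = ?E x" if "x \<in> J" for x
    using that
  proof (cases rule: J_cases)
    case 1
    then consider "x = pi/2" | "x = -(pi/2)" by linarith
    then show ?thesis
    proof cases
      case 1
      show ?thesis unfolding 1 by (simp add: lift_deriv_def pi_gt_zero not_le)
    next
      case 2
      show ?thesis unfolding 2 by (simp add: lift_deriv_def)
    qed
  next
    case (2 t)
    have "cos x > 0" "\<not> x \<le> -(pi/2)" "\<not> x \<ge> pi/2"
      using 2 arctan_bounded[of t] by (auto intro: cos_gt_zero_pi)
    moreover have "1 + (tan x)\<^sup>2 = 1 / (cos x)\<^sup>2"
      using tan_sec[of x] calculation(1) by (simp add: power_one_over inverse_eq_divide)
    moreover have "1 + (tan x + c)\<^sup>2 = ((cos x)\<^sup>2 + (sin x + c * cos x)\<^sup>2) / (cos x)\<^sup>2"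
      using calculation(1) by (simp add: tan_def field_simps power2_eq_square)
    ultimately show ?thesis by (simp add: lift_deriv_def)
  qed
  note F = translation_chart_C1[of c]
  show ?thesis
  proof (rule Diff_memI[where f' = ?E])
    show "(lift ?F has_real_derivative ?E x) (at x within J)" if "x \<in> J" for x
      using lift_has_deriv[OF F that] eq[OF that] by simp
    show "Ck_on k J ?E" for k
      using nz by (intro Ck_on_divide Ck_on_add Ck_on_power Ck_on_mult Ck_on_const Ck_on_cos Ck_on_sin)
  qed (use chart_C1_bij[OF F] lift_Bij lift_strict_mono nz in simp_all)
qed

lemma lift_Diff_of_compact_support:
  assumes "strict_mono F" "surj F" and Ck: "\<And>k. Ck_on k UNIV F"
    and pos: "\<And>t. deriv F t > 0"
    and supp: "\<And>t. \<bar>t\<bar> \<ge> R \<Longrightarrow> F t = t"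
  shows "lift F \<in> carrier (Diff r (-(pi/2)) (pi/2))"
proof -
  \<comment> \<open>\<open>G\<close> extends \<open>lift F\<close> by the identity to the whole
    line. It is the identity on the open set |x| > arctan |R|, which contains both endpoints, so
    smoothness can be checked locally.\<close>
  define G where "G x = (if \<bar>x\<bar> < pi/2 then arctan (F (tan x)) else x)" for x
  have Gid: "G x = x" if "\<bar>x\<bar> > arctan \<bar>R\<bar>" for x
  proof (cases "\<bar>x\<bar> < pi/2")
    case True
    have "tan \<bar>x\<bar> \<ge> 0" using True by (intro tan_pos_pi2_le) auto
    then have "\<bar>tan x\<bar> = tan \<bar>x\<bar>" by (auto simp: abs_if split: if_splits)
    moreover have "tan \<bar>x\<bar> > tan (arctan \<bar>R\<bar>)"
      using that True arctan_bounded[of "\<bar>R\<bar>"] by (subst tan_mono_lt_eq) (auto simp: abs_if)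
    ultimately have "\<bar>tan x\<bar> \<ge> R" by (simp add: tan_arctan)
    then show ?thesis using True supp by (simp add: G_def arctan_tan abs_less_iff)
  qed (simp add: G_def)
  have smooth: "Ck_on k UNIV G" for k
  proof (rule Ck_on_local)
    fix x :: real
    show "\<exists>U. open U \<and> x \<in> U \<and> Ck_on k U G"
    proof (cases "\<bar>x\<bar> < pi/2")
      case True
      have "Ck_on k {-(pi/2)<..<pi/2} (\<lambda>x. arctan (F (tan x)))"
        by (intro Ck_on_arctan Ck_on_comp[OF _ Ck] Ck_on_tan) auto
      then have "Ck_on k {-(pi/2)<..<pi/2} G"
        by (subst Ck_on_cong[where g = "\<lambda>x. arctan (F (tan x))"]) (auto simp: G_def)
      then show ?thesis using True
        by (intro exI[of _ "{-(pi/2)<..<pi/2}"]) (auto simp: abs_less_iff simp del: Ck_on.simps)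
    next
      case False
      let ?U = "{x. \<bar>x\<bar> > arctan \<bar>R\<bar>}"
      have "Ck_on k ?U G" by (subst Ck_on_cong[where g = "\<lambda>x. x"]) (auto simp: Gid Ck_on_ident)
      moreover have "open ?U" by (intro open_Collect_less continuous_intros)
      moreover have "x \<in> ?U" using False arctan_bounded[of "\<bar>R\<bar>"] by auto
      ultimately show ?thesis by blast
    qed
  qed
  have dG: "(G has_real_derivative deriv G x) (at x)" and smooth': "Ck_on k UNIV (deriv G)" for x k
    using Ck_on_open_deriv[OF open_UNIV smooth[of "Suc k"]] by blast+
  have dF: "(F has_real_derivative deriv F t) (at t)" for t
    using Ck_on_open_deriv[OF open_UNIV Ck[of "Suc 0"]] by blast
  have eq: "lift F x = G x" if "x \<in> J" for x using that by (auto simp: lift_def G_def)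
  have pos': "deriv G x > 0" for x
  proof (cases "\<bar>x\<bar> < pi/2")
    case True
    have "(lift F has_real_derivative deriv F (tan x) * (1 + (tan x)\<^sup>2) / (1 + (F (tan x))\<^sup>2)) (at x)"
      using lift_has_deriv_interior[OF dF True] .
    then have "(G has_real_derivative deriv F (tan x) * (1 + (tan x)\<^sup>2) / (1 + (F (tan x))\<^sup>2)) (at x)"
    proof (rule has_field_derivative_transform_within_open)
      show "open {-(pi/2)<..<pi/2}" "x \<in> {-(pi/2)<..<pi/2}" using True by auto
      show "lift F y = G y" if "y \<in> {-(pi/2)<..<pi/2}" for y
        by (rule eq) (use that in auto)
    qed
    then have "deriv G x = deriv F (tan x) * (1 + (tan x)\<^sup>2) / (1 + (F (tan x))\<^sup>2)"
      by (rule DERIV_imp_deriv)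
    moreover have "1 + (tan x)\<^sup>2 > 0" "1 + (F (tan x))\<^sup>2 > 0" by (simp_all add: add_pos_nonneg)
    ultimately show ?thesis using pos[of "tan x"] by simp
  next
    case False
    have "((\<lambda>x. x) has_real_derivative 1) (at x)" by simp
    then have "(G has_real_derivative 1) (at x)"
    proof (rule has_field_derivative_transform_within_open)
      show "open {x. \<bar>x\<bar> > arctan \<bar>R\<bar>}" by (intro open_Collect_less continuous_intros)
      show "x \<in> {x. \<bar>x\<bar> > arctan \<bar>R\<bar>}" using False arctan_bounded[of "\<bar>R\<bar>"] by auto
      show "y = G y" if "y \<in> {x. \<bar>x\<bar> > arctan \<bar>R\<bar>}" for y using Gid[of y] that by simp
    qed
    then have "deriv G x = 1" by (rule DERIV_imp_deriv)
    then show ?thesis by simp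
  qed
  show ?thesis
  proof (rule Diff_memI[where f' = "deriv G"])
    show "(lift F has_real_derivative deriv G x) (at x within J)" if "x \<in> J" for x
    proof (rule has_field_derivative_transform_within[OF _ zero_less_one that])
      show "(G has_real_derivative deriv G x) (at x within J)"
        using dG by (rule has_field_derivative_at_within)
      show "G y = lift F y" if "y \<in> J" for y using eq[OF that] by simp
    qed
    show "Ck_on k J (deriv G)" for k using smooth' Ck_on_subset by blast
    show "lift F \<in> Bij J"
      using assms(1,2) by (intro lift_Bij) (auto simp: bij_def intro: strict_mono_imp_inj_on)
  qed (use pos' lift_strict_mono[OF assms(1)] in \<open>simp_all add: less_imp_neq[symmetric]\<close>)
qed


subsection \<open>A compactly supported flow\<close>

text \<open>The powers make the family closed under differentiation up to linear combinations, so
  smoothness of the classical \<open>flat 0\<close> is an induction over the whole family.\<close>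

definition flat :: "nat \<Rightarrow> real \<Rightarrow> real" where
  "flat n r = (if r > 0 then exp (- inverse r) * inverse r ^ n else 0)"

lemma flat_tendsto_0: "(flat n \<longlongrightarrow> 0) (at 0)"
proof -
  have "((\<lambda>u::real. u ^ n / exp u) \<longlongrightarrow> 0) at_top" by (rule tendsto_power_div_exp_0)
  then have "((\<lambda>r::real. inverse r ^ n / exp (inverse r)) \<longlongrightarrow> 0) (at_right 0)"
    by (rule filterlim_compose) (rule filterlim_inverse_at_top_right)
  then have "(flat n \<longlongrightarrow> 0) (at_right 0)"
    by (rule Lim_transform_eventually)
      (use eventually_at_right_less[of 0] in \<open>eventually_elim,
        simp add: flat_def exp_minus divide_inverse mult.commute\<close>)
  moreover have "(flat n \<longlongrightarrow> 0) (at_left 0)"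
  proof (rule tendsto_eventually)
    show "\<forall>\<^sub>F x in at_left 0. flat n x = 0"
      by (auto simp: flat_def eventually_at_filter)
  qed
  ultimately show ?thesis by (simp add: filterlim_split_at)
qed

lemma DERIV_flat: "(flat n has_real_derivative flat (n + 2) r - real n * flat (n + 1) r) (at r)"
proof -
  consider "r > 0" | "r < 0" | "r = 0" by linarith
  then show ?thesis
  proof cases
    case 1
    have i: "(inverse has_real_derivative - (inverse r * inverse r)) (at r)"
      using 1 DERIV_inverse[of r UNIV] by (simp add: power2_eq_square)
    have "((\<lambda>r. exp (- inverse r) * inverse r ^ n) has_real_derivative
        exp (- inverse r) * - (- (inverse r * inverse r)) * inverse r ^ n +
        real n * (- (inverse r * inverse r) * inverse r ^ (n - Suc 0)) * exp (- inverse r)) (at r)"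
      by (intro DERIV_mult DERIV_fun_exp DERIV_minus DERIV_power i)
    also have "exp (- inverse r) * - (- (inverse r * inverse r)) * inverse r ^ n +
        real n * (- (inverse r * inverse r) * inverse r ^ (n - Suc 0)) * exp (- inverse r) =
        flat (n + 2) r - real n * flat (n + 1) r"
      \<comment> \<open>At \<open>n = 0\<close> the exponent \<open>n - Suc 0\<close> is truncated,
        but its term carries the factor \<open>real n\<close>.\<close>
      using 1 by (cases n) (simp_all add: flat_def algebra_simps)
    finally have "((\<lambda>r. exp (- inverse r) * inverse r ^ n) has_real_derivative
        flat (n + 2) r - real n * flat (n + 1) r) (at r)" .
    then show ?thesis
      by (rule has_field_derivative_transform_within_open[where S = "{0<..}"])
        (use 1 in \<open>auto simp: flat_def\<close>)
  next
    case 2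
    have "((\<lambda>r. 0) has_real_derivative flat (n + 2) r - real n * flat (n + 1) r) (at r)"
      using 2 by (simp add: flat_def)
    then show ?thesis
      by (rule has_field_derivative_transform_within_open[where S = "{..<0}"])
        (use 2 in \<open>auto simp: flat_def\<close>)
  next
    case 3
    \<comment> \<open>The difference quotient of \<open>flat n\<close> at 0 is
      \<open>flat (n + 1)\<close>, on both sides.\<close>
    have "((\<lambda>h. (flat n h - flat n 0) / (h - 0)) \<longlongrightarrow> 0) (at 0)"
      using flat_tendsto_0[of "n + 1"]
    proof (rule Lim_transform_eventually)
      show "\<forall>\<^sub>F h in at 0. flat (n + 1) h = (flat n h - flat n 0) / (h - 0)"
        by (auto simp: flat_def divide_inverse eventually_at_filter)
    qed
    then show ?thesis unfolding 3 by (simp add: has_field_derivative_iff flat_def)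
  qed
qed

lemma Ck_on_flat: "Ck_on k UNIV (flat n)"
proof (induction k arbitrary: n)
  case 0
  show ?case using DERIV_flat by (auto intro!: continuous_at_imp_continuous_on DERIV_isCont)
next
  case (Suc k)
  have "Ck_on k UNIV (\<lambda>r. flat (n + 2) r - real n * flat (n + 1) r)"
    by (intro Ck_on_diff Ck_on_mult Ck_on_const Suc.IH)
  then show ?case using DERIV_flat by (intro Ck_on_SucI) 
qed

text \<open>The translation by \<open>s\<close> conjugated by \<open>sinh\<close>, that is, the flow
  of the vector field with speed 1 / cosh y. The exponential decay of the speed makes the flow flat
  at the edges once it is seen through \<open>tan\<close>.\<close>

definition line_flow :: "real \<Rightarrow> real \<Rightarrow> real" where
  "line_flow s y = arsinh (sinh y + s)"

text \<open>The extension by the identity to the whole line allows translates of this flow to be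
  placed in all windows.\<close>

definition bump_flow :: "real \<Rightarrow> real \<Rightarrow> real" where
  "bump_flow s x = (if \<bar>x\<bar> < pi/2 then arctan (line_flow s (tan x)) else x)"

lemma bump_flow_outside: "\<bar>x\<bar> \<ge> pi/2 \<Longrightarrow> bump_flow s x = x"
  by (simp add: bump_flow_def)

lemma bump_flow_inside: "\<bar>x\<bar> < pi/2 \<Longrightarrow> \<bar>bump_flow s x\<bar> < pi/2"
  by (simp add: bump_flow_def abs_arctan_less del: less_divide_eq_numeral1)

lemma bump_flow_add: "bump_flow s (bump_flow s' x) = bump_flow (s + s') x"
proof (cases "\<bar>x\<bar> < pi/2")
  case True
  have "bump_flow s (arctan y) = arctan (line_flow s y)" for y
    using abs_arctan_less[of y] unfolding bump_flow_def by (simp only: tan_arctan if_True)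
  then show ?thesis using True by (simp add: bump_flow_def line_flow_def add_ac)
qed (simp add: bump_flow_def)

lemma bump_flow_0: "bump_flow 0 x = x"
  by (auto simp: bump_flow_def line_flow_def arsinh_sinh_real arctan_tan abs_less_iff)

lemma sinh_diff_ge: "y \<le> z \<Longrightarrow> z - y \<le> sinh z - sinh (y::real)"
proof -
  assume "y \<le> z"
  then have "sinh y - y \<le> sinh z - z"
    by (rule DERIV_nonneg_imp_nondecreasing)
      (auto intro!: exI derivative_eq_intros simp: cosh_real_ge_1)
  then show ?thesis by simp
qed

text \<open>\<open>sinh\<close> expands distances because cosh is at least 1, so moving
  \<open>sinh y\<close> by \<open>s\<close> moves \<open>y\<close> by at most |s|.\<close>

lemma line_flow_displacement: "\<bar>line_flow s y - y\<bar> \<le> \<bar>s\<bar>"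
proof -
  have "sinh (line_flow s y) - sinh y = s" by (simp add: line_flow_def)
  then show ?thesis
    using sinh_diff_ge[of y "line_flow s y"] sinh_diff_ge[of "line_flow s y" y] by (cases "y \<le> line_flow s y") auto
qed

lemma DERIV_line_flow: "(line_flow s has_real_derivative cosh y / cosh (line_flow s y)) (at y)"
proof -
  have "((\<lambda>y. sinh y + s) has_real_derivative cosh y) (at y)"
    by (auto intro!: derivative_eq_intros)
  from DERIV_chain2[OF arsinh_real_has_field_derivative this]
  show ?thesis by (simp add: line_flow_def[abs_def] cosh_arsinh_real)
qed

lemma DERIV_bump_flow_inside:
  assumes "\<bar>x\<bar> < pi/2"
  shows "(bump_flow s has_real_derivative
    (1 + (tan x)\<^sup>2) / (1 + (line_flow s (tan x))\<^sup>2) * (cosh (tan x) / cosh (line_flow s (tan x)))) (at x)"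
proof -
  have "(lift (line_flow s) has_real_derivative
     cosh (tan x) / cosh (line_flow s (tan x)) * (1 + (tan x)\<^sup>2) / (1 + (line_flow s (tan x))\<^sup>2)) (at x)"
    by (rule lift_has_deriv_interior[OF DERIV_line_flow assms])
  then have "(bump_flow s has_real_derivative
     cosh (tan x) / cosh (line_flow s (tan x)) * (1 + (tan x)\<^sup>2) / (1 + (line_flow s (tan x))\<^sup>2)) (at x)"
  proof (rule has_field_derivative_transform_within_open)
    show "open {-(pi/2)<..<pi/2}" "x \<in> {-(pi/2)<..<pi/2}" using assms by auto
    show "lift (line_flow s) y = bump_flow s y" if "y \<in> {-(pi/2)<..<pi/2}" for y
    proof -
      have "\<bar>y\<bar> < pi/2" using that by auto
      then show ?thesis by (simp add: lift_interior bump_flow_def)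
    qed
  qed
  then show ?thesis by (simp add: mult_ac)
qed

definition chart_displacement :: "real \<Rightarrow> real \<Rightarrow> real" where
  "chart_displacement s x = (if \<bar>x\<bar> < pi/2 then line_flow s (tan x) - tan x else 0)"

text \<open>With \<open>y = tan x\<close>, \<open>q = exp (- y)\<close> and \<open>w = sinh y + s\<close>, the displacement \<open>arsinh w - y\<close> is the
  logarithm of \<open>q w + sqrt (q\<^sup>2 w\<^sup>2 + q\<^sup>2)\<close>, where \<open>q w = (1 - q\<^sup>2) / 2 + s q\<close>; the flat function \<open>q\<close> extends smoothly
  by \<open>0\<close> beyond \<open>x = pi/2\<close>.\<close>

lemma chart_displacement_right:
  fixes s :: real
  defines "z \<equiv> \<lambda>q. (1 - q\<^sup>2) / 2 + s * q"
  assumes x: "0 < x" "x < pi"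
  shows "chart_displacement s x =
    ln (z (flat 0 (cos x / sin x)) + sqrt ((z (flat 0 (cos x / sin x)))\<^sup>2 + (flat 0 (cos x / sin x))\<^sup>2))"
proof (cases "x < pi/2")
  case True
  let ?y = "tan x" and ?q = "flat 0 (cos x / sin x)"
  have "cos x > 0" "sin x > 0" using x True by (auto intro: cos_gt_zero sin_gt_zero)
  then have q: "?q = exp (- ?y)" by (simp add: flat_def tan_def)
  define w where "w = sinh ?y + s"
  have "z ?q = ?q * w"
    unfolding z_def w_def q sinh_field_def by (simp add: field_simps power2_eq_square exp_minus)
  moreover have "sqrt ((?q * w)\<^sup>2 + ?q\<^sup>2) = ?q * sqrt (w\<^sup>2 + 1)"
  proof -
    have "(?q * w)\<^sup>2 + ?q\<^sup>2 = ?q\<^sup>2 * (w\<^sup>2 + 1)" by (simp add: power_mult_distrib algebra_simps)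
    then show ?thesis by (simp add: real_sqrt_mult q)
  qed
  ultimately have "z ?q + sqrt ((z ?q)\<^sup>2 + ?q\<^sup>2) = ?q * (w + sqrt (w\<^sup>2 + 1))"
    by (simp add: algebra_simps)
  also have "ln \<dots> = - ?y + arsinh w"
    using arsinh_real_aux[of w] by (simp add: ln_mult q arsinh_real_def)
  finally show ?thesis using x True by (simp add: chart_displacement_def line_flow_def w_def)
next
  case False
  then have "cos x \<le> 0" "sin x > 0" using x by (auto intro: sin_gt_zero cos_monotone_0_pi_le[of "pi/2" x, simplified])
  \<comment> \<open>The cotangent is nonpositive here, so \<open>flat 0\<close> vanishes and the
    formula reads ln (1/2 + 1/2) = 0.\<close>
  then have "flat 0 (cos x / sin x) = 0" by (auto simp: flat_def divide_pos_pos dest: divide_nonpos_pos)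
  then show ?thesis using False x by (simp add: z_def chart_displacement_def real_sqrt_divide power2_eq_square)
qed

lemma Ck_on_chart_displacement_right: "Ck_on k {0<..<pi} (chart_displacement s)"
proof -
  define z :: "real \<Rightarrow> real" where "z q = (1 - q\<^sup>2) / 2 + s * q" for q
  let ?q = "\<lambda>x. flat 0 (cos x / sin x)"
  \<comment> \<open>As \<open>z 0 = 1/2\<close>, the values \<open>z q\<close> and \<open>q\<close>
    never vanish together, so the square root avoids its singularity.\<close>
  have sq: "(z q)\<^sup>2 + q\<^sup>2 > 0" for q
    by (cases "q = 0") (auto simp: z_def sum_power2_gt_zero_iff)
  have pos: "z q + sqrt ((z q)\<^sup>2 + q\<^sup>2) > 0" for q
  proof (cases "q = 0")
    case False
    then have "sqrt ((z q)\<^sup>2 + q\<^sup>2) > sqrt ((z q)\<^sup>2)" by (intro real_sqrt_less_mono) simp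
    then show ?thesis by simp
  qed (simp add: z_def power2_eq_square real_sqrt_divide)
  \<comment> \<open>The cotangent is smooth across pi/2, where \<open>tan\<close> is not;
    \<open>flat 0\<close> inverts its argument and so returns exp (- tan x) to the left of
    pi/2.\<close>
  have q: "Ck_on k {0<..<pi} ?q"
    by (intro Ck_on_comp[OF _ Ck_on_flat] Ck_on_divide Ck_on_sin Ck_on_cos)
      (auto dest: sin_gt_zero)
  have z: "Ck_on k {0<..<pi} (\<lambda>x. z (?q x))"
    unfolding z_def by (intro Ck_on_add Ck_on_mult Ck_on_const Ck_on_divide Ck_on_diff Ck_on_power q) auto
  have "Ck_on k {0<..<pi} (\<lambda>x. ln (z (?q x) + sqrt ((z (?q x))\<^sup>2 + (?q x)\<^sup>2)))"
    by (intro Ck_on_ln Ck_on_add Ck_on_sqrt Ck_on_power q z pos sq)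
  then show ?thesis
    by (rule Ck_on_cong[THEN iffD2, rotated]) (simp add: chart_displacement_right z_def)
qed

text \<open>The symmetry y -> -y reverses the flow; it carries the smoothness at pi/2 over to
  -pi/2.\<close>

lemma chart_displacement_minus: "chart_displacement s (- x) = - chart_displacement (- s) x"
proof -
  have "line_flow s (- y) = - line_flow (- s) y" for y
    unfolding line_flow_def by (subst arsinh_minus_real[symmetric]) simp
  then show ?thesis by (simp add: chart_displacement_def)
qed

lemma Ck_on_chart_displacement: "Ck_on k UNIV (chart_displacement s)"
proof (rule Ck_on_local)
  fix x :: real
  consider "\<bar>x\<bar> < pi/2" | "pi/2 < \<bar>x\<bar>" | "x = pi/2" | "x = - (pi/2)" by linarith
  then show "\<exists>U. open U \<and> x \<in> U \<and> Ck_on k U (chart_displacement s)"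
  proof cases
    case 1
    have "Ck_on k {-(pi/2)<..<pi/2} (\<lambda>x. line_flow s (tan x) - tan x)"
      unfolding line_flow_def
      by (intro Ck_on_diff Ck_on_arsinh Ck_on_add Ck_on_sinh Ck_on_const Ck_on_tan)
    then have "Ck_on k {-(pi/2)<..<pi/2} (chart_displacement s)"
      by (rule Ck_on_cong[THEN iffD2, rotated]) (auto simp: chart_displacement_def)
    moreover have "x \<in> {-(pi/2)<..<pi/2}" using 1 by auto
    ultimately show ?thesis using open_greaterThanLessThan by meson
  next
    case 2
    have "Ck_on k {x. pi/2 < \<bar>x\<bar>} (chart_displacement s)"
      by (rule Ck_on_cong[THEN iffD2, rotated, OF Ck_on_const[of _ _ 0]])
        (auto simp: chart_displacement_def)
    moreover have "open {x::real. pi/2 < \<bar>x\<bar>}" by (intro open_Collect_less continuous_intros)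
    moreover have "x \<in> {x. pi/2 < \<bar>x\<bar>}" using 2 by simp
    ultimately show ?thesis by meson
  next
    case 3
    then have "x \<in> {0<..<pi}"
      unfolding greaterThanLessThan_iff using pi_gt_zero by (intro conjI; linarith)
    then show ?thesis using Ck_on_chart_displacement_right open_greaterThanLessThan by meson
  next
    case 4
    have "Ck_on k {-pi<..<0} (\<lambda>x. - chart_displacement (- s) (- x))"
      by (intro Ck_on_minus Ck_on_comp[OF _ Ck_on_chart_displacement_right] Ck_on_ident) auto
    then have "Ck_on k {-pi<..<0} (chart_displacement s)"
      using chart_displacement_minus[of "- s"] by simp
    moreover have "x \<in> {-pi<..<0}"
      unfolding greaterThanLessThan_iff using 4 pi_gt_zero by (intro conjI; linarith)
    ultimately show ?thesis using open_greaterThanLessThan by meson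
  qed
qed

text \<open>The chart \<open>tan\<close> degenerates at the endpoints; the formula for the tangent of a difference removes it
  from the displacement of \<^term>\<open>bump_flow s\<close>.\<close>

lemma bump_flow_eq:
  fixes s x :: real
  defines "d \<equiv> chart_displacement s x"
  assumes s: "\<bar>s\<bar> \<le> 1"
  shows "1 + d * (sin x * cos x) > 0"
    and "bump_flow s x = x + arctan (d * (cos x)\<^sup>2 / (1 + d * (sin x * cos x)))"
proof -
  have "\<bar>d\<bar> \<le> 1"
    using line_flow_displacement[of s "tan x"] s by (auto simp: d_def chart_displacement_def)
  \<comment> \<open>The product is half of sin (2 x); together with |d| \<le> |s| \<le> 1 this keeps
    the denominator at least 1/2.\<close>
  moreover have sc: "\<bar>sin x * cos x\<bar> \<le> 1/2"
  proof -
    have "\<bar>2 * sin x * cos x\<bar> \<le> 1" unfolding sin_double[symmetric] by simp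
    then show ?thesis by (simp add: abs_mult)
  qed
  ultimately have "\<bar>d * (sin x * cos x)\<bar> \<le> 1 * (1/2)" unfolding abs_mult by (intro mult_mono) auto
  then show pos: "1 + d * (sin x * cos x) > 0" by linarith
  show "bump_flow s x = x + arctan (d * (cos x)\<^sup>2 / (1 + d * (sin x * cos x)))"
  proof (cases "\<bar>x\<bar> < pi/2")
    case True
    let ?a = "bump_flow s x"
    have a: "\<bar>?a\<bar> < pi/2" by (rule bump_flow_inside[OF True])
    have ta: "tan ?a = tan x + d" using True
      by (simp add: bump_flow_def d_def chart_displacement_def tan_arctan)
    have ca: "cos ?a > 0" and cx: "cos x > 0"
      by (rule cos_gt_zero_pi; use a True in linarith)+
    have tx: "tan x * cos x = sin x" using cx by (simp add: tan_def)
    have "1 + tan ?a * tan x = (1 + d * (sin x * cos x)) / (cos x)\<^sup>2"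
    proof -
      have "(1 + (tan x + d) * tan x) * (cos x)\<^sup>2 = (cos x)\<^sup>2 + (tan x * cos x)\<^sup>2 + d * ((tan x * cos x) * cos x)"
        by (simp add: power2_eq_square algebra_simps)
      also have "\<dots> = 1 + d * (sin x * cos x)" unfolding tx using sin_cos_squared_add[of x] by simp
      finally show ?thesis using cx unfolding ta by (simp add: field_simps)
    qed
    then have p: "1 + tan ?a * tan x > 0" using pos cx by simp
    have "cos (?a - x) = cos ?a * cos x * (1 + tan ?a * tan x)"
      using ca cx by (simp add: cos_diff tan_def field_simps)
    then have cd: "cos (?a - x) > 0" using p ca cx by simp
    \<comment> \<open>The tangent determines \<open>?a - x\<close> only modulo pi; the positive
      cosine selects the principal branch.\<close>
    have "\<bar>?a - x\<bar> < pi" using a True by linarith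
    moreover have "\<not> \<bar>?a - x\<bar> \<ge> pi/2"
    proof
      assume "\<bar>?a - x\<bar> \<ge> pi/2"
      then have "cos \<bar>?a - x\<bar> \<le> 0" using cos_monotone_0_pi_le[of "pi/2" "\<bar>?a - x\<bar>"] \<open>\<bar>?a - x\<bar> < pi\<close> by simp
      then show False using cd unfolding cos_abs_real by simp
    qed
    ultimately have r: "-(pi/2) < ?a - x" "?a - x < pi/2" by linarith+
    have "tan (?a - x) = d / (1 + tan ?a * tan x)"
      using tan_diff[of ?a x] ca cx cd ta by simp
    also have "\<dots> = d * (cos x)\<^sup>2 / (1 + d * (sin x * cos x))"
      unfolding \<open>1 + tan ?a * tan x = (1 + d * (sin x * cos x)) / (cos x)\<^sup>2\<close> by simp
    finally show ?thesis using arctan_unique[OF r] by simp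
  qed (simp add: bump_flow_def d_def chart_displacement_def)
qed

lemma Ck_on_bump_flow:
  assumes "\<bar>s\<bar> \<le> 1" shows "Ck_on k UNIV (bump_flow s)"
proof -
  let ?d = "chart_displacement s"
  have "Ck_on k UNIV (\<lambda>x. x + arctan (?d x * (cos x)\<^sup>2 / (1 + ?d x * (sin x * cos x))))"
    using bump_flow_eq(1)[OF assms]
    by (intro Ck_on_add Ck_on_ident Ck_on_arctan Ck_on_divide Ck_on_mult Ck_on_power Ck_on_cos
        Ck_on_sin Ck_on_const Ck_on_chart_displacement) (simp add: less_imp_neq[symmetric])
  then show ?thesis
    by (rule Ck_on_cong[THEN iffD2, rotated]) (rule bump_flow_eq(2)[OF assms])
qed

lemma bump_flow_C1:
  assumes "\<bar>s\<bar> \<le> 1"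
  shows "(bump_flow s has_real_derivative deriv (bump_flow s) x) (at x)" "isCont (deriv (bump_flow s)) x"
proof -
  show "(bump_flow s has_real_derivative deriv (bump_flow s) x) (at x)"
    using Ck_on_open_deriv[OF open_UNIV Ck_on_bump_flow[OF assms, of "Suc 0"]] by blast
  have "continuous_on UNIV (deriv (bump_flow s))"
    using Ck_on_open_deriv[OF open_UNIV Ck_on_bump_flow[OF assms, of "Suc 0"]] by simp
  then show "isCont (deriv (bump_flow s)) x" by (simp add: continuous_on_eq_continuous_at)
qed

text \<open>The derivative is already known to exist, so even at the two edges it can be computed
  from the outer side, where all difference quotients are 1.\<close>

lemma deriv_bump_flow_outside:
  assumes s: "\<bar>s\<bar> \<le> 1" and x: "\<bar>x\<bar> \<ge> pi/2"
  shows "deriv (bump_flow s) x = 1"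
proof -
  have der: "((\<lambda>y. (bump_flow s y - bump_flow s x) / (y - x)) \<longlongrightarrow> deriv (bump_flow s) x) (at x)"
    using bump_flow_C1(1)[OF s] by (simp add: has_field_derivative_iff)
  show ?thesis
  proof (cases "x > 0")
    case True
    have "\<forall>\<^sub>F y in at_right x. (bump_flow s y - bump_flow s x) / (y - x) = 1"
      using eventually_at_right_less[of x]
    proof eventually_elim
      case (elim y)
      then have "\<bar>y\<bar> \<ge> pi/2" using True x by linarith
      then show ?case using x elim by (simp add: bump_flow_outside)
    qed
    then have "((\<lambda>y. (bump_flow s y - bump_flow s x) / (y - x)) \<longlongrightarrow> 1) (at_right x)"
      by (rule tendsto_eventually)
    moreover have "((\<lambda>y. (bump_flow s y - bump_flow s x) / (y - x)) \<longlongrightarrow> deriv (bump_flow s) x) (at_right x)"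
      using der by (rule filterlim_mono) (auto intro: at_le)
    ultimately show ?thesis by (rule tendsto_unique[OF trivial_limit_at_right_real, rotated])
  next
    case False
    have "\<forall>\<^sub>F y in at_left x. y \<in> {x - 1<..<x}" by (rule eventually_at_left_real) simp
    then have "\<forall>\<^sub>F y in at_left x. (bump_flow s y - bump_flow s x) / (y - x) = 1"
    proof eventually_elim
      case (elim y)
      then have "\<bar>y\<bar> \<ge> pi/2" "y \<noteq> x" using False x by auto
      then show ?case using x by (simp add: bump_flow_outside)
    qed
    then have "((\<lambda>y. (bump_flow s y - bump_flow s x) / (y - x)) \<longlongrightarrow> 1) (at_left x)"
      by (rule tendsto_eventually)
    moreover have "((\<lambda>y. (bump_flow s y - bump_flow s x) / (y - x)) \<longlongrightarrow> deriv (bump_flow s) x) (at_left x)"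
      using der by (rule filterlim_mono) (auto intro: at_le)
    ultimately show ?thesis by (rule tendsto_unique[OF trivial_limit_at_left_real, rotated])
  qed
qed

section \<open>Distortion of the bump flow\<close>

lemma one_plus_square_le:
  fixes a b d :: real
  assumes "\<bar>a - b\<bar> \<le> d" "d \<le> 1"
  shows "1 + a\<^sup>2 \<le> (1 + 2 * d) * (1 + b\<^sup>2)"
proof -
  define e where "e = \<bar>a - b\<bar>"
  have e: "0 \<le> e" "e \<le> d" "e \<le> 1" using assms by (auto simp: e_def)
  have "\<bar>a\<bar> \<le> \<bar>b\<bar> + e" by (simp add: e_def)
  then have "a\<^sup>2 \<le> (\<bar>b\<bar> + e)\<^sup>2" using e by (simp add: abs_le_square_iff[symmetric])
  also have "\<dots> = b\<^sup>2 + e * (2 * \<bar>b\<bar>) + e * e" by (simp add: power2_eq_square algebra_simps)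
  also have "e * (2 * \<bar>b\<bar>) \<le> e * (1 + b\<^sup>2)"
  proof -
    have "0 \<le> (1 - \<bar>b\<bar>)\<^sup>2" by simp
    then have "2 * \<bar>b\<bar> \<le> 1 + b\<^sup>2" by (simp add: power2_eq_square algebra_simps)
    then show ?thesis using e by (intro mult_left_mono)
  qed
  also have "e * e \<le> e * (1 + b\<^sup>2)" using e by (intro mult_left_mono) (auto intro: order_trans)
  finally have "1 + a\<^sup>2 \<le> (1 + 2 * e) * (1 + b\<^sup>2)" by (simp add: algebra_simps)
  also have "\<dots> \<le> (1 + 2 * d) * (1 + b\<^sup>2)" using e by (intro mult_right_mono) auto
  finally show ?thesis .
qed

lemma cosh_le_exp_mult:
  fixes a b d :: real
  assumes "\<bar>a - b\<bar> \<le> d"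
  shows "cosh a \<le> exp d * cosh b"
proof -
  have "exp a \<le> exp d * exp b" "exp (- a) \<le> exp d * exp (- b)"
    using assms by (simp_all add: exp_add[symmetric])
  then show ?thesis by (simp add: cosh_field_def algebra_simps)
qed

text \<open>The product of the bounds for the two factors of the derivative, the ratio of 1 + y^2
  and the ratio of cosh y, over points at distance at most |s|. It tends to 1 as \<open>s\<close>
  tends to 0.\<close>

definition distortion_bound :: "real \<Rightarrow> real" where
  "distortion_bound s = (1 + 2 * \<bar>s\<bar>) * exp \<bar>s\<bar>"

lemma distortion_bound_ge_1: "distortion_bound s \<ge> 1"
proof -
  have "1 * 1 \<le> (1 + 2 * \<bar>s\<bar>) * exp \<bar>s\<bar>" by (intro mult_mono) auto
  then show ?thesis by (simp add: distortion_bound_def)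
qed

lemma deriv_bump_flow_inside:
  assumes "\<bar>x\<bar> < pi/2"
  shows "deriv (bump_flow s) x =
    (1 + (tan x)\<^sup>2) / (1 + (line_flow s (tan x))\<^sup>2) * (cosh (tan x) / cosh (line_flow s (tan x)))"
  by (rule DERIV_imp_deriv[OF DERIV_bump_flow_inside[OF assms]])

lemma deriv_bump_flow_bounds:
  assumes s: "\<bar>s\<bar> \<le> 1"
  shows "inverse (distortion_bound s) \<le> deriv (bump_flow s) x" "deriv (bump_flow s) x \<le> distortion_bound s"
proof -
  have "inverse (distortion_bound s) \<le> deriv (bump_flow s) x \<and> deriv (bump_flow s) x \<le> distortion_bound s"
  proof (cases "\<bar>x\<bar> < pi/2")
    case True
    let ?y = "tan x" and ?z = "line_flow s (tan x)"
    have d: "\<bar>?z - ?y\<bar> \<le> \<bar>s\<bar>" "\<bar>?y - ?z\<bar> \<le> \<bar>s\<bar>" using line_flow_displacement[of s ?y] by auto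
    have p: "1 + ?y\<^sup>2 > 0" "1 + ?z\<^sup>2 > 0" "cosh ?y > 0" "cosh ?z > 0"
      by (simp_all add: add_pos_nonneg cosh_real_pos)
    have D: "deriv (bump_flow s) x = ((1 + ?y\<^sup>2) * cosh ?y) / ((1 + ?z\<^sup>2) * cosh ?z)"
      by (simp add: deriv_bump_flow_inside[OF True])
    have 1: "(1 + ?y\<^sup>2) * cosh ?y \<le> distortion_bound s * ((1 + ?z\<^sup>2) * cosh ?z)"
      using mult_mono[OF one_plus_square_le[OF d(2) s] cosh_le_exp_mult[OF d(2)]] p
      by (simp add: distortion_bound_def mult_ac)
    have 2: "(1 + ?z\<^sup>2) * cosh ?z \<le> distortion_bound s * ((1 + ?y\<^sup>2) * cosh ?y)"
      using mult_mono[OF one_plus_square_le[OF d(1) s] cosh_le_exp_mult[OF d(1)]] p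
      by (simp add: distortion_bound_def mult_ac)
    have q: "(1 + ?y\<^sup>2) * cosh ?y > 0" "(1 + ?z\<^sup>2) * cosh ?z > 0" using p by simp_all
    show ?thesis
    proof
      show "deriv (bump_flow s) x \<le> distortion_bound s"
        unfolding D using 1 q by (simp add: pos_divide_le_eq)
      show "inverse (distortion_bound s) \<le> deriv (bump_flow s) x"
        unfolding D using 2 q distortion_bound_ge_1[of s] by (simp add: field_simps)
    qed
  next
    case False
    then show ?thesis
      using deriv_bump_flow_outside[OF s, of x] distortion_bound_ge_1[of s]
      by (simp add: inverse_le_1_iff)
  qed
  then show "inverse (distortion_bound s) \<le> deriv (bump_flow s) x" "deriv (bump_flow s) x \<le> distortion_bound s"
    by blast+
qed

lemma deriv_bump_flow_pos: "\<bar>s\<bar> \<le> 1 \<Longrightarrow> deriv (bump_flow s) x > 0"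
  using deriv_bump_flow_bounds(1)[of s x] distortion_bound_ge_1[of s]
  by (meson inverse_positive_iff_positive less_le_trans zero_less_one)

text \<open>The source of the linear growth: the log-derivative at the centre of a window differs
  from its value 0 at the edge.\<close>

lemma deriv_bump_flow_1_0: "deriv (bump_flow 1) 0 < 1"
proof -
  let ?z = "line_flow 1 0"
  have "?z > 0" by (simp add: line_flow_def)
  then have "1 < 1 + ?z\<^sup>2" by simp
  also have "\<dots> * 1 \<le> \<dots> * cosh ?z"
    using cosh_real_ge_1[of ?z] by (intro mult_left_mono) auto
  finally show ?thesis by (simp add: deriv_bump_flow_inside divide_simps)
qed


subsection \<open>Windows and the half shift\<close>

definition win :: "real \<Rightarrow> int" where
  "win t = \<lfloor>t / pi + 1/2\<rfloor>"

lemma win_eq_iff: "win t = j \<longleftrightarrow> pi * j - pi/2 \<le> t \<and> t < pi * j + pi/2"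
proof -
  have "real_of_int j \<le> t / pi + 1/2 \<longleftrightarrow> pi * j - pi/2 \<le> t"
    "t / pi + 1/2 < real_of_int j + 1 \<longleftrightarrow> t < pi * j + pi/2"
    using pi_gt_zero by (auto simp: field_simps simp del: pi_gt_zero)
  then show ?thesis by (simp add: win_def floor_eq_iff)
qed

lemma win_bounds: "pi * win t - pi/2 \<le> t" "t < pi * win t + pi/2"
  using win_eq_iff[of t "win t"] by auto

lemma win_less_iff: "win t < j \<longleftrightarrow> t < pi * j - pi/2"
proof -
  have "t / pi + 1/2 < real_of_int j \<longleftrightarrow> t < pi * j - pi/2"
    using pi_gt_zero by (auto simp: field_simps simp del: pi_gt_zero)
  then show ?thesis by (simp add: win_def floor_less_iff)
qed

lemma win_add: "win (t + pi * real_of_int m) = win t + m"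
  using win_bounds[of t] by (subst win_eq_iff) (simp add: algebra_simps)

text \<open>The windows tile the line and are preserved, so composing such maps adds their times
  \<open>c\<close>. Identities in the group thus reduce to identities between functions on the
  integers.\<close>

definition windows :: "(int \<Rightarrow> real) \<Rightarrow> real \<Rightarrow> real" where
  "windows c t = pi * win t + bump_flow (c (win t)) (t - pi * win t)"

lemma windows_cong: "c (win t) = c' (win t) \<Longrightarrow> windows c t = windows c' t"
  by (simp add: windows_def)

lemma windows_eq_self: "c (win t) = 0 \<Longrightarrow> windows c t = t"
  by (simp add: windows_def bump_flow_0)

lemma win_windows: "win (windows c t) = win t"
proof (cases "t = pi * win t - pi/2")
  \<comment> \<open>The windows are half-open; the left edge is their only point that is not
    interior, and it is fixed.\<close>
  case True
  then have "windows c t = t" unfolding windows_def by (subst bump_flow_outside) linarith+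
  then show ?thesis by simp
next
  case False
  then have "\<bar>t - pi * win t\<bar> < pi/2" using win_bounds[of t] by linarith
  then have "\<bar>bump_flow (c (win t)) (t - pi * win t)\<bar> < pi/2" by (rule bump_flow_inside)
  then show ?thesis unfolding win_eq_iff windows_def by linarith
qed

lemma windows_add: "windows c (windows c' t) = windows (\<lambda>j. c j + c' j) t"
proof -
  have "windows c (windows c' t) =
      pi * win t + bump_flow (c (win t)) (windows c' t - pi * win t)"
    by (subst windows_def) (simp only: win_windows)
  then show ?thesis by (simp add: windows_def bump_flow_add)
qed

lemma windows_shift: "windows c (t + pi * real_of_int m) = windows (\<lambda>j. c (j + m)) t + pi * m"
  unfolding windows_def win_add by (simp add: algebra_simps)

lemma windows_displacement: "\<bar>windows c t - t\<bar> \<le> pi"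
  using win_bounds[of t] win_bounds[of "windows c t"] unfolding win_windows by linarith

text \<open>At each point at most one of the two displacement terms is nonzero, so a single smooth
  formula is valid across the common edge of the windows \<open>j - 1\<close> and \<open>j\<close>.
  As a window contains only its left edge, the left neighbour suffices.\<close>

lemma windows_eq_sum:
  assumes "pi * j - 3 * pi/2 < t" "t < pi * j + pi/2"
  shows "windows c t = t + (bump_flow (c (j - 1)) (t - pi * real_of_int (j - 1)) - (t - pi * real_of_int (j - 1)))
    + (bump_flow (c j) (t - pi * j) - (t - pi * j))"
proof (cases "t < pi * j - pi/2")
  case True
  then have "win t = j - 1" unfolding win_eq_iff using assms by (auto simp: algebra_simps)
  moreover have "bump_flow (c j) (t - pi * j) = t - pi * j"
    using True assms by (intro bump_flow_outside) linarith
  ultimately show ?thesis by (simp add: windows_def)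
next
  case False
  then have "win t = j" using assms by (auto simp: win_eq_iff)
  moreover have "bump_flow (c (j - 1)) (t - pi * real_of_int (j - 1)) = t - pi * real_of_int (j - 1)"
    using False by (intro bump_flow_outside) (simp add: algebra_simps abs_if)
  ultimately show ?thesis by (simp add: windows_def)
qed

lemma window_neighbourhood:
  defines "U \<equiv> \<lambda>j. {pi * real_of_int j - 3 * pi/2<..<pi * real_of_int j + pi/2}"
  shows "open (U (win t))" "t \<in> U (win t)"
proof -
  show "open (U (win t))" by (simp add: U_def)
  show "t \<in> U (win t)"
    unfolding U_def greaterThanLessThan_iff using win_bounds[of t] pi_gt_zero by (intro conjI; linarith)
qed

lemma Ck_on_windows:
  assumes c: "\<And>j. \<bar>c j\<bar> \<le> 1"
  shows "Ck_on k UNIV (windows c)"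
proof (rule Ck_on_local)
  fix t :: real
  let ?U = "{pi * real_of_int (win t) - 3 * pi/2<..<pi * real_of_int (win t) + pi/2}"
  let ?S = "\<lambda>x. x + (bump_flow (c (win t - 1)) (x - pi * real_of_int (win t - 1)) - (x - pi * real_of_int (win t - 1)))
    + (bump_flow (c (win t)) (x - pi * win t) - (x - pi * win t))"
  have "Ck_on k ?U ?S"
    by (intro Ck_on_add Ck_on_diff Ck_on_comp[OF _ Ck_on_bump_flow[OF c]] Ck_on_ident Ck_on_const) auto
  then have "Ck_on k ?U (windows c)"
    by (rule Ck_on_cong[THEN iffD2, rotated]) (intro windows_eq_sum; simp)
  then show "\<exists>U. open U \<and> t \<in> U \<and> Ck_on k U (windows c)"
    using window_neighbourhood[of t] by meson
qed

lemma windows_C1: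
  assumes c: "\<And>j. \<bar>c j\<bar> \<le> 1"
  shows "(windows c has_real_derivative deriv (windows c) t) (at t)" "isCont (deriv (windows c)) t"
proof -
  note D = Ck_on_open_deriv[OF open_UNIV Ck_on_windows[of c "Suc 0", OF c]]
  show "(windows c has_real_derivative deriv (windows c) t) (at t)" using D by blast
  have "continuous_on UNIV (deriv (windows c))" using D by simp
  then show "isCont (deriv (windows c)) t" by (simp add: continuous_on_eq_continuous_at)
qed

lemma deriv_windows:
  assumes c: "\<And>j. \<bar>c j\<bar> \<le> 1"
  shows "deriv (windows c) t = deriv (bump_flow (c (win t))) (t - pi * win t)"
proof (rule DERIV_imp_deriv)
  let ?i = "win t"
  let ?a = "\<lambda>x. x - pi * real_of_int (?i - 1)" and ?b = "\<lambda>x. x - pi * real_of_int ?i"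
  have ab: "(?a has_real_derivative 1) (at t)" "(?b has_real_derivative 1) (at t)"
    by (auto intro!: derivative_eq_intros)
  have "((\<lambda>x. x + (bump_flow (c (?i - 1)) (?a x) - ?a x) + (bump_flow (c ?i) (?b x) - ?b x))
    has_real_derivative 1 + (deriv (bump_flow (c (?i - 1))) (?a t) * 1 - 1) +
      (deriv (bump_flow (c ?i)) (?b t) * 1 - 1)) (at t)"
    by (intro DERIV_add DERIV_diff DERIV_ident DERIV_chain2[OF bump_flow_C1(1)[OF c]] ab)
  moreover have "deriv (bump_flow (c (?i - 1))) (?a t) = 1"
    using win_bounds(1)[of t] by (intro deriv_bump_flow_outside c) (simp add: algebra_simps abs_if)
  ultimately have D: "((\<lambda>x. x + (bump_flow (c (?i - 1)) (?a x) - ?a x) + (bump_flow (c ?i) (?b x) - ?b x))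
    has_real_derivative deriv (bump_flow (c ?i)) (?b t)) (at t)" by simp
  then show "(windows c has_real_derivative deriv (bump_flow (c ?i)) (?b t)) (at t)"
  proof (rule has_field_derivative_transform_within_open[OF _ window_neighbourhood])
    show "x + (bump_flow (c (?i - 1)) (?a x) - ?a x) + (bump_flow (c ?i) (?b x) - ?b x) = windows c x"
      if "x \<in> {pi * real_of_int ?i - 3 * pi/2<..<pi * real_of_int ?i + pi/2}" for x
      using that by (intro windows_eq_sum[symmetric]; simp)
  qed
qed

lemma deriv_windows_pos: "(\<And>j. \<bar>c j\<bar> \<le> 1) \<Longrightarrow> deriv (windows c) t > 0"
  by (simp add: deriv_windows deriv_bump_flow_pos)

lemma distortion_bound_tendsto: "(f \<longlongrightarrow> 0) A \<Longrightarrow> ((\<lambda>x. distortion_bound (f x)) \<longlongrightarrow> 1) A"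
proof -
  assume f: "(f \<longlongrightarrow> 0) A"
  have "((\<lambda>x. (1 + 2 * \<bar>f x\<bar>) * exp \<bar>f x\<bar>) \<longlongrightarrow> (1 + 2 * \<bar>0\<bar>) * exp \<bar>0\<bar>) A"
    by (intro tendsto_intros f)
  then show ?thesis by (simp add: distortion_bound_def)
qed

text \<open>At \<open>t\<close> the derivative lies between
  \<open>distortion_bound (c (win t))\<close> and its inverse, and both tend to 1 as the times tend
  to 0.\<close>

lemma windows_chart_C1:
  assumes c: "\<And>j. \<bar>c j\<bar> \<le> 1" and neg: "\<And>j. j < 0 \<Longrightarrow> c j = 0"
    and lim: "(\<lambda>n. c (int n)) \<longlonglongrightarrow> 0"
  shows "chart_C1 (windows c) (deriv (windows c)) 1 1"
proof (rule chart_C1_of_bounded_displacement[OF windows_C1[OF c] deriv_windows_pos[OF c] windows_displacement])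
  have squeeze: "(deriv (windows c) \<longlongrightarrow> 1) A" if "((\<lambda>t. c (win t)) \<longlongrightarrow> 0) A" for A
  proof (rule tendsto_sandwich[where f = "\<lambda>t. inverse (distortion_bound (c (win t)))"])
    show "((\<lambda>t. distortion_bound (c (win t))) \<longlongrightarrow> 1) A"
      by (rule distortion_bound_tendsto[OF that])
    then show "((\<lambda>t. inverse (distortion_bound (c (win t)))) \<longlongrightarrow> 1) A"
      using tendsto_inverse by fastforce
  qed (simp_all add: deriv_windows c deriv_bump_flow_bounds)
  have "\<forall>\<^sub>F t in at_bot. c (win t) = 0"
    using eventually_gt_at_bot[of "- pi/2"] by (auto simp: eventually_at_bot_dense win_less_iff intro!: neg exI[of _ "-pi/2"])
  then show "(deriv (windows c) \<longlongrightarrow> 1) at_bot" by (intro squeeze tendsto_eventually)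
  have "filterlim win at_top at_top"
    unfolding filterlim_at_top
  proof
    fix j :: int
    show "\<forall>\<^sub>F t in at_top. j \<le> win t"
      using eventually_ge_at_top[of "pi * j - pi/2"] by eventually_elim (simp add: win_less_iff flip: not_less)
  qed
  then have "filterlim (\<lambda>t. nat (win t)) sequentially at_top"
    by (rule filterlim_compose[OF filterlim_nat_sequentially])
  then have "((\<lambda>t. c (int (nat (win t)))) \<longlongrightarrow> 0) at_top" by (rule filterlim_compose[OF lim])
  then have "((\<lambda>t. c (win t)) \<longlongrightarrow> 0) at_top"
  proof (rule Lim_transform_eventually)
    show "\<forall>\<^sub>F t in at_top. c (int (nat (win t))) = c (win t)"
      using eventually_ge_at_top[of "- (pi/2)"] by eventually_elim (simp add: win_less_iff flip: not_less)
  qed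
  then show "(deriv (windows c) \<longlongrightarrow> 1) at_top" by (rule squeeze)
qed

lemma windows_lift_Diff:
  assumes c: "\<And>j. \<bar>c j\<bar> \<le> 1" and supp: "\<And>j. j < 0 \<or> j \<ge> N \<Longrightarrow> c j = 0"
  shows "lift (windows c) \<in> carrier (Diff r (-(pi/2)) (pi/2))"
proof (rule lift_Diff_of_compact_support)
  show "strict_mono (windows c)"
    by (rule strict_mono_of_deriv_pos[OF windows_C1(1)[OF c] deriv_windows_pos[OF c]])
  show "surj (windows c)"
    using DERIV_isCont[OF windows_C1(1)[OF c]] windows_displacement by (rule surj_of_bounded_displacement)
  show "windows c t = t" if "\<bar>t\<bar> \<ge> pi * \<bar>real_of_int N\<bar> + pi" for t
  proof (rule windows_eq_self, rule supp, rule ccontr)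
    assume "\<not> (win t < 0 \<or> win t \<ge> N)"
    then have "\<not> win t < 0" "win t < N" by auto
    then have "- (pi/2) \<le> t" "t < pi * N - pi/2" by (auto simp: win_less_iff)
    moreover have "pi * N \<le> pi * \<bar>real_of_int N\<bar>" "0 \<le> pi * \<bar>real_of_int N\<bar>" by simp_all
    ultimately show False using that pi_gt_zero by linarith
  qed
qed (use Ck_on_windows[OF c] deriv_windows_pos[OF c] in auto)

section \<open>The half shift\<close>

lemma DERIV_max_0_square: "((\<lambda>u. (max 0 u)\<^sup>2) has_real_derivative 2 * max 0 u) (at u)"
proof -
  consider "u > 0" | "u < 0" | "u = 0" by linarith
  then show ?thesis
  proof cases
    case 1
    have "((\<lambda>u. u\<^sup>2) has_real_derivative 2 * max 0 u) (at u)"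
      using 1 by (auto intro!: derivative_eq_intros)
    then show ?thesis
      by (rule has_field_derivative_transform_within_open[where S = "{0<..}"]) (use 1 in auto)
  next
    case 2
    have "((\<lambda>u. 0) has_real_derivative 2 * max 0 u) (at u)"
      using 2 by (auto intro!: derivative_eq_intros)
    then show ?thesis
      by (rule has_field_derivative_transform_within_open[where S = "{..<0}"]) (use 2 in auto)
  next
    case 3
    have "((\<lambda>h::real. (max 0 h)\<^sup>2 / h) \<longlongrightarrow> 0) (at 0)"
    proof (rule Lim_null_comparison)
      show "\<forall>\<^sub>F h in at 0. norm ((max 0 h)\<^sup>2 / h) \<le> \<bar>h\<bar>"
        by (auto simp: eventually_at_filter max_def power2_eq_square)
      show "((\<lambda>h. \<bar>h\<bar>) \<longlongrightarrow> 0) (at (0::real))" by (rule tendsto_rabs_zero) (rule tendsto_ident_at)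
    qed
    then show ?thesis unfolding 3 by (simp add: has_field_derivative_iff)
  qed
qed

text \<open>A second difference of the \<open>C\<^sup>1\<close> function \<open>(max 0 u)\<^sup>2\<close> is a \<open>C\<^sup>1\<close> step.\<close>

definition half_shift :: "real \<Rightarrow> real" where
  "half_shift t = t + 2 * pi * ((max 0 (t/pi + 3/2))\<^sup>2 - 2 * (max 0 (t/pi + 1))\<^sup>2 + (max 0 (t/pi + 1/2))\<^sup>2)"

definition half_shift_deriv :: "real \<Rightarrow> real" where
  "half_shift_deriv t = 1 + 4 * (max 0 (t/pi + 3/2) - 2 * max 0 (t/pi + 1) + max 0 (t/pi + 1/2))"

lemma DERIV_half_shift: "(half_shift has_real_derivative half_shift_deriv t) (at t)"
proof -
  have lin: "((\<lambda>t. t/pi + k) has_real_derivative 1/pi) (at t)" for k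
    by (auto intro!: derivative_eq_intros)
  have "(half_shift has_real_derivative 1 + 2 * pi * (2 * max 0 (t/pi + 3/2) * (1/pi)
      - 2 * (2 * max 0 (t/pi + 1) * (1/pi)) + 2 * max 0 (t/pi + 1/2) * (1/pi))) (at t)"
    unfolding half_shift_def[abs_def]
    by (intro DERIV_add DERIV_ident DERIV_cmult DERIV_diff DERIV_chain2[OF DERIV_max_0_square] lin)
  then show ?thesis by (simp add: half_shift_deriv_def algebra_simps)
qed

lemma half_shift_left: "t \<le> - (3 * pi/2) \<Longrightarrow> half_shift t = t \<and> half_shift_deriv t = 1"
proof -
  assume "t \<le> - (3 * pi/2)"
  then have "t/pi + 3/2 \<le> 0" by (simp add: field_simps)
  then have "max 0 (t/pi + 3/2) = 0" "max 0 (t/pi + 1) = 0" "max 0 (t/pi + 1/2) = 0" by auto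
  then show ?thesis by (simp add: half_shift_def half_shift_deriv_def)
qed

lemma half_shift_right: "t \<ge> - (pi/2) \<Longrightarrow> half_shift t = t + pi \<and> half_shift_deriv t = 1"
proof -
  assume "t \<ge> - (pi/2)"
  then have "t/pi + 1/2 \<ge> 0" by (simp add: field_simps)
  then have m: "max 0 (t/pi + 3/2) = t/pi + 3/2" "max 0 (t/pi + 1) = t/pi + 1" "max 0 (t/pi + 1/2) = t/pi + 1/2"
    by auto
  \<comment> \<open>The second difference of the square with step 1/2 is 2 (1/2)^2 = 1/2; the factor
    2 pi turns it into a shift by pi.\<close>
  have "(u + 3/2)\<^sup>2 - 2 * (u + 1)\<^sup>2 + (u + 1/2)\<^sup>2 = 1/2" for u :: real
    by (simp add: power2_eq_square algebra_simps)
  then have "half_shift t = t + 2 * pi * (1/2)" unfolding half_shift_def m by (simp only:)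
  then show ?thesis unfolding half_shift_deriv_def m by simp
qed

text \<open>The bracket is a second difference of the convex function \<open>max 0 u\<close>, hence
  nonnegative.\<close>

lemma half_shift_deriv_pos: "half_shift_deriv t > 0"
  by (auto simp: half_shift_deriv_def max_def)

lemma half_shift_middle:
  assumes "- (3 * pi/2) \<le> t" "t < - (pi/2)"
  shows "- (3 * pi/2) \<le> half_shift t" "half_shift t < pi/2"
proof -
  have mono: "strict_mono half_shift"
    by (rule strict_mono_of_deriv_pos[OF DERIV_half_shift half_shift_deriv_pos])
  have "half_shift (- (3 * pi/2)) \<le> half_shift t" "half_shift t < half_shift (- (pi/2))"
    using assms strict_mono_less[OF mono] strict_mono_less_eq[OF mono] by blast+
  then show "- (3 * pi/2) \<le> half_shift t" "half_shift t < pi/2"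
    using half_shift_left[of "- (3 * pi/2)"] half_shift_right[of "- (pi/2)"] by auto
qed

lemma half_shift_chart_C1: "chart_C1 half_shift half_shift_deriv 1 1"
proof (rule chart_C1_of_bounded_displacement[OF DERIV_half_shift _ half_shift_deriv_pos])
  show "isCont half_shift_deriv t" for t
    unfolding half_shift_deriv_def[abs_def] by (intro continuous_intros) auto
  show "\<bar>half_shift t - t\<bar> \<le> 2 * pi" for t
  proof -
    consider "t \<le> - (3 * pi/2)" | "t \<ge> - (pi/2)" | "- (3 * pi/2) \<le> t" "t < - (pi/2)" by linarith
    then show ?thesis
    proof cases
      case 3
      then show ?thesis using half_shift_middle[of t] by linarith
    qed (use half_shift_left[of t] half_shift_right[of t] in simp_all)
  qed
  show "(half_shift_deriv \<longlongrightarrow> 1) at_bot"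
    by (intro tendsto_eventually eventually_mono[OF eventually_le_at_bot[of "- (3 * pi/2)"]])
      (use half_shift_left in blast)
  show "(half_shift_deriv \<longlongrightarrow> 1) at_top"
    by (intro tendsto_eventually eventually_mono[OF eventually_ge_at_top[of "- (pi/2)"]])
      (use half_shift_right in blast)
qed

text \<open>The conjugate of \<open>half_shift\<close> by the \<open>p\<close>-th power of the
  translation by 2 pi, which makes it a short word later.\<close>

definition half_shift_at :: "int \<Rightarrow> real \<Rightarrow> real" where
  "half_shift_at p t = half_shift (t - 2 * pi * p) + 2 * pi * p"

text \<open>The transition zone of the half shift is the window \<open>2 * p - 1\<close>.\<close>

lemma half_shift_at_windows:
  assumes c: "c (2 * p - 1) = 0"
  shows "half_shift_at p (windows c t) = windows (\<lambda>j. if j < 2 * p then c j else c (j - 1)) (half_shift_at p t)"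
proof -
  let ?c = "\<lambda>j. if j < 2 * p then c j else c (j - 1)"
  have left: "half_shift_at p t = t" if "win t < 2 * p - 1" for t
  proof -
    have "t < pi * real_of_int (2 * p - 1) - pi/2" using that win_less_iff by blast
    then have "t - 2 * pi * p \<le> - (3 * pi/2)" by (simp add: algebra_simps)
    from half_shift_left[OF this] show ?thesis by (simp add: half_shift_at_def)
  qed
  have right: "half_shift_at p t = t + pi * real_of_int 1" if "\<not> win t < 2 * p" for t
  proof -
    have "\<not> t < pi * real_of_int (2 * p) - pi/2" using that win_less_iff by blast
    then have "t - 2 * pi * p \<ge> - (pi/2)" by (simp add: algebra_simps)
    from half_shift_right[OF this] show ?thesis by (simp add: half_shift_at_def)
  qed
  consider "win t < 2 * p - 1" | "win t = 2 * p - 1" | "\<not> win t < 2 * p" by linarith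
  then show ?thesis
  proof cases
    case 1
    have "windows ?c t = windows c t" using 1 by (intro windows_cong) simp
    then show ?thesis using left[OF 1] left[of "windows c t"] 1 by (simp add: win_windows)
  next
    case 2
    then have "pi * real_of_int (2 * p - 1) - pi/2 \<le> t" "t < pi * real_of_int (2 * p - 1) + pi/2"
      using win_eq_iff by blast+
    then have "- (3 * pi/2) \<le> t - 2 * pi * p" "t - 2 * pi * p < - (pi/2)"
      by (auto simp: algebra_simps)
    from half_shift_middle[OF this]
    have "\<not> half_shift_at p t < pi * real_of_int (2 * p - 1) - pi/2"
      "half_shift_at p t < pi * real_of_int (2 * p + 1) - pi/2"
      by (auto simp: half_shift_at_def algebra_simps)
    then have "\<not> win (half_shift_at p t) < 2 * p - 1" "win (half_shift_at p t) < 2 * p + 1"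
      using win_less_iff by blast+
    \<comment> \<open>In either of these windows the new time is \<open>c (2 * p - 1) = 0\<close>,
      so both sides equal \<open>half_shift_at p t\<close>.\<close>
    then have "win (half_shift_at p t) = 2 * p - 1 \<or> win (half_shift_at p t) = 2 * p" by linarith
    then show ?thesis using 2 c by (auto simp: windows_eq_self)
  next
    case 3
    have "windows ?c (half_shift_at p t) = windows (\<lambda>j. ?c (j + 1)) t + pi * real_of_int 1"
      unfolding right[OF 3] by (rule windows_shift)
    also have "windows (\<lambda>j. ?c (j + 1)) t = windows c t" using 3 by (intro windows_cong) simp
    finally show ?thesis using right[of "windows c t"] 3 by (simp add: win_windows)
  qed
qed


subsection \<open>Variation of the logarithm of the derivative\<close>

lemma Diff_mult:
  assumes "f \<in> carrier (Diff r a b)" "g \<in> carrier (Diff r a b)"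
  shows "f \<otimes>\<^bsub>Diff r a b\<^esub> g = compose {a..b} f g"
  using assms by (simp add: Diff_def BijGroup_def)

lemma Diff_one: "\<one>\<^bsub>Diff r a b\<^esub> = (\<lambda>x\<in>{a..b}. x)"
  by (simp add: Diff_def BijGroup_def)

lemma has_real_derivative_within_Icc_unique:
  fixes f :: "real \<Rightarrow> real"
  assumes "a < b" "x \<in> {a..b}"
    and "(f has_real_derivative d) (at x within {a..b})" "(f has_real_derivative e) (at x within {a..b})"
  shows "d = e"
proof -
  have "at x within {a..b} \<noteq> bot" using assms(1,2) by (simp add: trivial_limit_within islimpt_Icc)
  then show ?thesis using assms(3,4) unfolding has_field_derivative_iff by (rule tendsto_unique)
qed

text \<open>Differentiating the composition of \<open>f\<close> with its differentiable inverse
  shows that \<open>f'\<close> does not vanish; monotonicity gives the sign.\<close>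

lemma Diff_deriv_pos:
  assumes ab: "a < b" and f: "f \<in> carrier (Diff r a b)" and r: "1 \<le> r"
    and der: "\<And>x. x \<in> {a..b} \<Longrightarrow> (f has_real_derivative f' x) (at x within {a..b})"
    and x: "x \<in> {a..b}"
  shows "f' x > 0"
proof -
  let ?I = "{a..b}" let ?g = "inv_into {a..b} f"
  have bij: "bij_betw f ?I ?I" and mono: "strict_mono_on ?I f" and "C_on r ?I ?g"
    using f by (auto simp: Diff_def Bij_def)
  then have "Ck_on (Suc 0) ?I ?g" using r by (simp add: C_on_def one_enat_def del: Ck_on.simps)
  then obtain g' where g': "\<And>y. y \<in> ?I \<Longrightarrow> (?g has_real_derivative g' y) (at y within ?I)"
    unfolding Ck_on.simps by blast
  have fI: "f ` ?I = ?I" using bij by (simp add: bij_betw_def)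
  have "((?g \<circ> f) has_real_derivative g' (f x) * f' x) (at x within ?I)"
    using g'[of "f x"] der[OF x] x fI by (intro DERIV_image_chain) (auto simp del: atLeastAtMost_iff)
  moreover have "((?g \<circ> f) has_real_derivative 1) (at x within ?I)"
  proof (rule has_field_derivative_transform_within[OF DERIV_ident zero_less_one x])
    show "y = (?g \<circ> f) y" if "y \<in> ?I" for y using bij_betw_inv_into_left[OF bij that] by simp
  qed
  ultimately have "g' (f x) * f' x = 1" using has_real_derivative_within_Icc_unique[OF ab x] by blast
  then have "f' x \<noteq> 0" by auto
  moreover have "f' x \<ge> 0"
  proof (rule tendsto_lowerbound)
    show "((\<lambda>y. (f y - f x) / (y - x)) \<longlongrightarrow> f' x) (at x within ?I)"
      using der[OF x] by (simp add: has_field_derivative_iff)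
    show "\<forall>\<^sub>F y in at x within ?I. 0 \<le> (f y - f x) / (y - x)"
    proof -
      have "0 \<le> (f y - f x) / (y - x)" if "y \<in> ?I" "y \<noteq> x" for y
        using strict_mono_onD[OF mono x that(1)] strict_mono_onD[OF mono that(1) x] that(2)
        by (cases "y < x") (auto simp: divide_simps)
      then show ?thesis by (auto simp: eventually_at_filter)
    qed
    show "at x within ?I \<noteq> bot" using ab x by (simp add: trivial_limit_within islimpt_Icc)
  qed
  ultimately show ?thesis by simp
qed

text \<open>\<open>L\<close> is any bound for the total variation of log f'. Partitions are monotone
  sequences cut off at \<open>N\<close>, with repetitions allowed, so a monotone map sends
  partitions to partitions.\<close>

definition log_variation :: "real \<Rightarrow> real \<Rightarrow> real \<Rightarrow> (real \<Rightarrow> real) \<Rightarrow> bool" where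
  "log_variation L a b f \<longleftrightarrow>
     (\<exists>f'. (\<forall>x\<in>{a..b}. (f has_real_derivative f' x) (at x within {a..b}) \<and> f' x > 0) \<and>
       (\<forall>x N. mono x \<and> range x \<subseteq> {a..b} \<longrightarrow> (\<Sum>j<N. \<bar>ln (f' (x (Suc j))) - ln (f' (x j))\<bar>) \<le> L))"

lemma log_variation_id: "log_variation 0 a b (\<lambda>x\<in>{a..b}. x)"
  unfolding log_variation_def
proof (intro exI[of _ "\<lambda>_. 1"] conjI ballI allI impI)
  fix x assume "x \<in> {a..b}"
  show "((\<lambda>x\<in>{a..b}. x) has_real_derivative 1) (at x within {a..b})"
    by (rule has_field_derivative_transform_within[OF DERIV_ident zero_less_one \<open>x \<in> {a..b}\<close>]) simp
qed simp_all

text \<open>By the chain rule log (f o g)' is the sum of log f' at \<open>g\<close> and log g', and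
  \<open>g\<close> carries each partition to a partition.\<close>

lemma log_variation_compose:
  assumes f: "log_variation L a b f" and g: "log_variation M a b g"
    and gI: "g ` {a..b} \<subseteq> {a..b}" and mono: "mono_on {a..b} g"
  shows "log_variation (L + M) a b (compose {a..b} f g)"
proof -
  let ?I = "{a..b}"
  obtain f' where f': "\<And>x. x \<in> ?I \<Longrightarrow> (f has_real_derivative f' x) (at x within ?I)" "\<And>x. x \<in> ?I \<Longrightarrow> f' x > 0"
    "\<And>x N. mono x \<Longrightarrow> range x \<subseteq> ?I \<Longrightarrow> (\<Sum>j<N. \<bar>ln (f' (x (Suc j))) - ln (f' (x j))\<bar>) \<le> L"
    using f unfolding log_variation_def by blast
  obtain g' where g': "\<And>x. x \<in> ?I \<Longrightarrow> (g has_real_derivative g' x) (at x within ?I)" "\<And>x. x \<in> ?I \<Longrightarrow> g' x > 0"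
    "\<And>x N. mono x \<Longrightarrow> range x \<subseteq> ?I \<Longrightarrow> (\<Sum>j<N. \<bar>ln (g' (x (Suc j))) - ln (g' (x j))\<bar>) \<le> M"
    using g unfolding log_variation_def by blast
  let ?h = "\<lambda>x. f' (g x) * g' x"
  have gx: "g x \<in> ?I" if "x \<in> ?I" for x using gI that by blast
  have "(compose ?I f g has_real_derivative ?h x) (at x within ?I)" if x: "x \<in> ?I" for x
  proof -
    have "((f \<circ> g) has_real_derivative ?h x) (at x within ?I)"
      using f'(1)[OF gx[OF x]] gI g'(1)[OF x] by (intro DERIV_image_chain) (rule DERIV_subset)
    then show ?thesis
      by (rule has_field_derivative_transform_within[OF _ zero_less_one x]) (simp add: compose_eq)
  qed
  moreover have "?h x > 0" if "x \<in> ?I" for x using f'(2) g'(2) gx that by simp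
  moreover have "(\<Sum>j<N. \<bar>ln (?h (x (Suc j))) - ln (?h (x j))\<bar>) \<le> L + M"
    if x: "mono x" "range x \<subseteq> ?I" for x :: "nat \<Rightarrow> real" and N
  proof -
    have xI: "x j \<in> ?I" for j using x(2) by blast
    have ln: "ln (?h (x j)) = ln (f' (g (x j))) + ln (g' (x j))" for j
      using f'(2)[OF gx[OF xI[of j]]] g'(2)[OF xI[of j]] by (simp add: ln_mult)
    have "mono (\<lambda>j. g (x j))"
      using x(1) mono xI unfolding mono_on_def mono_def by blast
    moreover have "range (\<lambda>j. g (x j)) \<subseteq> ?I" using xI gx by blast
    ultimately have 1: "(\<Sum>j<N. \<bar>ln (f' (g (x (Suc j)))) - ln (f' (g (x j)))\<bar>) \<le> L" by (rule f'(3))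
    have "(\<Sum>j<N. \<bar>ln (?h (x (Suc j))) - ln (?h (x j))\<bar>) \<le>
      (\<Sum>j<N. \<bar>ln (f' (g (x (Suc j)))) - ln (f' (g (x j)))\<bar> + \<bar>ln (g' (x (Suc j))) - ln (g' (x j))\<bar>)"
      unfolding ln by (intro sum_mono) linarith
    then show ?thesis using 1 g'(3)[OF x, of N] by (simp add: sum.distrib)
  qed
  ultimately show ?thesis unfolding log_variation_def by (intro exI[of _ ?h]) blast
qed

text \<open>Class C^2 enters here: log f' has derivative f'' / f', which is bounded by compactness,
  so log f' is Lipschitz.\<close>

lemma log_variation_Diff2:
  assumes ab: "a < b" and f: "f \<in> carrier (Diff 2 a b)"
  shows "\<exists>L. log_variation L a b f"
proof -
  let ?I = "{a..b}"
  have "C_on 2 ?I f" using f by (simp add: Diff_def)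
  then have "Ck_on (Suc (Suc 0)) ?I f" by (simp add: C_on_def numeral_2_eq_2[symmetric] numeral_eq_enat del: Ck_on.simps)
  then obtain f' f'' where d: "\<And>x. x \<in> ?I \<Longrightarrow> (f has_real_derivative f' x) (at x within ?I)"
      "\<And>x. x \<in> ?I \<Longrightarrow> (f' has_real_derivative f'' x) (at x within ?I)" "continuous_on ?I f''"
    unfolding Ck_on.simps by blast
  have "(1::enat) \<le> 2" by (simp add: one_enat_def numeral_eq_enat)
  from Diff_deriv_pos[OF ab f this d(1)] have pos: "f' x > 0" if "x \<in> ?I" for x using that by blast
  have "continuous_on ?I f'" using d(2) by (rule DERIV_continuous_on)
  then have "continuous_on ?I (\<lambda>x. f'' x / f' x)"
    using pos d(3) by (intro continuous_on_divide) (auto simp: less_imp_neq[symmetric] simp del: atLeastAtMost_iff)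
  then have "compact ((\<lambda>x. f'' x / f' x) ` ?I)" by (intro compact_continuous_image) simp_all
  then have "bounded ((\<lambda>x. f'' x / f' x) ` ?I)" by (rule compact_imp_bounded)
  then obtain B where "\<forall>z\<in>(\<lambda>x. f'' x / f' x) ` ?I. norm z \<le> B" unfolding bounded_iff by blast
  then have B: "norm (f'' x / f' x) \<le> B" if "x \<in> ?I" for x using that by blast
  have lip: "\<bar>ln (f' y) - ln (f' x)\<bar> \<le> B * (y - x)" if xy: "x \<in> ?I" "y \<in> ?I" "x \<le> y" for x y
  proof -
    have "norm (ln (f' y) - ln (f' x)) \<le> B * norm (y - x)"
    proof (rule field_differentiable_bound[where f' = "\<lambda>x. f'' x / f' x" and S = ?I])
      show "((\<lambda>x. ln (f' x)) has_real_derivative f'' z / f' z) (at z within ?I)" if "z \<in> ?I" for z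
        using d(2)[OF that] pos[OF that] by (auto intro!: derivative_eq_intros)
    qed (use xy B in auto)
    then show ?thesis using xy(3) by simp
  qed
  have "B \<ge> 0" using order_trans[OF norm_ge_zero B[of a]] ab by simp
  have "(\<Sum>j<N. \<bar>ln (f' (x (Suc j))) - ln (f' (x j))\<bar>) \<le> B * (b - a)"
    if x: "mono x" "range x \<subseteq> ?I" for x :: "nat \<Rightarrow> real" and N
  proof -
    have xI: "x j \<in> ?I" for j using x(2) by blast
    have "(\<Sum>j<N. \<bar>ln (f' (x (Suc j))) - ln (f' (x j))\<bar>) \<le> (\<Sum>j<N. B * (x (Suc j) - x j))"
      using x(1) by (intro sum_mono lip xI) (simp add: mono_def)
    also have "\<dots> = B * (x N - x 0)" by (simp add: sum_distrib_left[symmetric] sum_lessThan_telescope)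
    also have "\<dots> \<le> B * (b - a)"
      using \<open>B \<ge> 0\<close> xI[of N] xI[of 0] by (intro mult_left_mono) auto
    finally show ?thesis .
  qed
  then show ?thesis
    unfolding log_variation_def using d(1) pos by (intro exI[of _ "B * (b - a)"] exI[of _ f']) blast
qed

lemma log_variation_word:
  assumes "\<And>g. g \<in> A \<Longrightarrow> log_variation L a b g" and A: "A \<subseteq> carrier (Diff r a b)" and "set w \<subseteq> A"
  shows "foldr (\<lambda>x y. x \<otimes>\<^bsub>Diff r a b\<^esub> y) w \<one>\<^bsub>Diff r a b\<^esub> \<in> carrier (Diff r a b) \<and>
    log_variation (real (length w) * L) a b (foldr (\<lambda>x y. x \<otimes>\<^bsub>Diff r a b\<^esub> y) w \<one>\<^bsub>Diff r a b\<^esub>)"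
  using assms(3)
proof (induction w)
  case Nil
  show ?case using group.is_monoid[OF group_Diff, THEN monoid.one_closed, of r a b]
      log_variation_id[of a b, folded Diff_one[of r]] by simp
next
  case (Cons g w)
  let ?h = "foldr (\<lambda>x y. x \<otimes>\<^bsub>Diff r a b\<^esub> y) w \<one>\<^bsub>Diff r a b\<^esub>"
  have h: "?h \<in> carrier (Diff r a b)" "log_variation (real (length w) * L) a b ?h"
    and g: "g \<in> carrier (Diff r a b)" "log_variation L a b g"
    using Cons assms by auto
  have "?h ` {a..b} \<subseteq> {a..b}" "mono_on {a..b} ?h"
    using h(1) by (auto simp: Diff_def Bij_def bij_betw_def strict_mono_on_imp_mono_on simp del: atLeastAtMost_iff)
  from log_variation_compose[OF g(2) h(2) this]
  have "log_variation (real (length (g # w)) * L) a b (compose {a..b} g ?h)" by (simp add: algebra_simps)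
  then show ?case
    using Diff_mult[OF g(1) h(1)] monoid.m_closed[OF group.is_monoid[OF group_Diff] g(1) h(1)] by simp
qed

section \<open>Words and word length\<close>

lemma (in monoid) foldr_mult_closed: "set w \<subseteq> carrier G \<Longrightarrow> foldr (\<lambda>x y. x \<otimes> y) w \<one> \<in> carrier G"
  by (induction w) auto

lemma (in monoid) foldr_mult_append:
  assumes "set u \<subseteq> carrier G" "set v \<subseteq> carrier G"
  shows "foldr (\<lambda>x y. x \<otimes> y) (u @ v) \<one> = foldr (\<lambda>x y. x \<otimes> y) u \<one> \<otimes> foldr (\<lambda>x y. x \<otimes> y) v \<one>"
  using assms(1)
proof (induction u)
  case (Cons x u)
  then show ?case
    using foldr_mult_closed[of u] foldr_mult_closed[OF assms(2)] by (simp add: m_assoc)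
qed (simp add: foldr_mult_closed assms(2))

lemma (in group) generate_imp_word:
  assumes S: "S \<subseteq> carrier G" and g: "g \<in> generate G S"
  shows "\<exists>w. set w \<subseteq> S \<union> (\<lambda>s. inv s) ` S \<and> foldr (\<lambda>x y. x \<otimes> y) w \<one> = g"
  using g
proof (induction g rule: generate.induct)
  case one
  show ?case by (intro exI[of _ "[]"]) simp
next
  case (incl h)
  then show ?case using S by (intro exI[of _ "[h]"]) auto
next
  case (inv h)
  then show ?case using S by (intro exI[of _ "[inv h]"]) auto
next
  case (eng h1 h2)
  then obtain u v where uv: "set u \<subseteq> S \<union> (\<lambda>s. inv s) ` S" "foldr (\<lambda>x y. x \<otimes> y) u \<one> = h1"
    "set v \<subseteq> S \<union> (\<lambda>s. inv s) ` S" "foldr (\<lambda>x y. x \<otimes> y) v \<one> = h2" by blast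
  have "S \<union> (\<lambda>s. inv s) ` S \<subseteq> carrier G" using S by auto
  then show ?case using foldr_mult_append[of u v] uv by (intro exI[of _ "u @ v"]) auto
qed

lemma word_length_word:
  assumes G: "group G" and S: "S \<subseteq> carrier G" and g: "g \<in> generate G S"
  obtains w where "length w = word_length G S g" "set w \<subseteq> S \<union> (\<lambda>s. inv\<^bsub>G\<^esub> s) ` S"
    "foldr (\<lambda>x y. x \<otimes>\<^bsub>G\<^esub> y) w \<one>\<^bsub>G\<^esub> = g"
proof -
  have "\<exists>n w. length w = n \<and> set w \<subseteq> S \<union> (\<lambda>s. inv\<^bsub>G\<^esub> s) ` S \<and> foldr (\<lambda>x y. x \<otimes>\<^bsub>G\<^esub> y) w \<one>\<^bsub>G\<^esub> = g"
    using group.generate_imp_word[OF assms] by blast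
  from LeastI_ex[OF this] show ?thesis using that unfolding word_length_def by blast
qed

text \<open>Finitely many generators and their inverses share a variation bound \<open>C\<close>; by
  subadditivity the variation of a word is at most \<open>C\<close> times its length.\<close>

lemma distorted_imp_sublinear_log_variation:
  assumes ab: "a < b" and f: "distorted_in (Diff 2 a b) f"
  shows "\<exists>L. (\<forall>n. log_variation (L n) a b (f [^]\<^bsub>Diff 2 a b\<^esub> n)) \<and> (\<lambda>n. L n / real n) \<longlonglongrightarrow> 0"
proof -
  let ?G = "Diff 2 a b"
  interpret G: group ?G by (rule group_Diff)
  obtain \<Gamma> S where \<Gamma>: "subgroup \<Gamma> ?G" and S: "finite S" "S \<subseteq> carrier ?G" "generate ?G S = \<Gamma>" and "f \<in> \<Gamma>"
    and lim: "(\<lambda>n. real (word_length ?G S (f [^]\<^bsub>?G\<^esub> n)) / real n) \<longlonglongrightarrow> 0"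
    using f unfolding distorted_in_def finite_generating_set_def by blast
  let ?A = "S \<union> (\<lambda>s. inv\<^bsub>?G\<^esub> s) ` S"
  have A: "?A \<subseteq> carrier ?G" "finite ?A" using S by auto
  then have "\<forall>g\<in>?A. \<exists>L. log_variation L a b g" using log_variation_Diff2[OF ab] by blast
  then obtain l where l: "\<And>g. g \<in> ?A \<Longrightarrow> log_variation (l g) a b g" by metis
  \<comment> \<open>The inserted 0 keeps the maximum meaningful when there are no
    generators.\<close>
  define C where "C = Max (insert 0 (l ` ?A))"
  have C: "log_variation C a b g" if "g \<in> ?A" for g
  proof -
    have "l g \<le> C" unfolding C_def using A(2) that by (intro Max_ge) auto
    then show ?thesis using l[OF that] unfolding log_variation_def by (meson order_trans)
  qed
  have "log_variation (real (word_length ?G S (f [^]\<^bsub>?G\<^esub> n)) * C) a b (f [^]\<^bsub>?G\<^esub> n)" for n :: nat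
  proof -
    have "f [^]\<^bsub>?G\<^esub> n \<in> \<Gamma>"
      by (induction n) (simp_all add: \<open>f \<in> \<Gamma>\<close> subgroup.one_closed[OF \<Gamma>] subgroup.m_closed[OF \<Gamma>])
    then obtain w where "length w = word_length ?G S (f [^]\<^bsub>?G\<^esub> n)" "set w \<subseteq> ?A"
      "foldr (\<lambda>x y. x \<otimes>\<^bsub>?G\<^esub> y) w \<one>\<^bsub>?G\<^esub> = f [^]\<^bsub>?G\<^esub> n"
      using word_length_word[OF group_Diff S(2)] S(3) by blast
    then show ?thesis using log_variation_word[of ?A C, OF C A(1)] by metis
  qed
  moreover have "(\<lambda>n. real (word_length ?G S (f [^]\<^bsub>?G\<^esub> n)) * C / real n) \<longlonglongrightarrow> 0"
    using tendsto_mult_left[OF lim, of C] by (simp add: mult_ac)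
  ultimately show ?thesis
    by (intro exI[of _ "\<lambda>n. real (word_length ?G S (f [^]\<^bsub>?G\<^esub> n)) * C"] conjI allI)
qed


subsection \<open>The diffeomorphism and its powers\<close>

text \<open>\<open>windows (pulse n)\<close> is the product of the translates of h by 2 pi i for 0
  \<le> i < n.\<close>

definition pulse :: "int \<Rightarrow> int \<Rightarrow> real" where
  "pulse n j = (if 0 \<le> j \<and> j < 2 * n then (if even j then 1 else - 1) else 0)"

definition diffeo :: "real \<Rightarrow> real" where
  "diffeo t = windows (pulse 1) t - 2 * pi"

lemma abs_pulse_le: "\<bar>pulse n j\<bar> \<le> 1"
  by (simp add: pulse_def)

text \<open>Moved past the translation by -2 pi n, the next factor h acts on the windows 2 n and 2 n
  + 1, just after the windows used so far.\<close>

lemma diffeo_funpow: "(diffeo ^^ n) t = windows (pulse (int n)) t - 2 * pi * real n"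
proof (induction n)
  case 0
  show ?case by (simp add: windows_eq_self pulse_def)
next
  case (Suc n)
  have "(diffeo ^^ Suc n) t = diffeo (windows (pulse (int n)) t + pi * real_of_int (- 2 * int n))"
  proof -
    have "(diffeo ^^ n) t = windows (pulse (int n)) t + pi * real_of_int (- 2 * int n)"
      using Suc by (simp add: algebra_simps)
    then show ?thesis by simp
  qed
  also have "\<dots> = windows (\<lambda>j. pulse 1 (j + - 2 * int n)) (windows (pulse (int n)) t) - 2 * pi * real (Suc n)"
    unfolding diffeo_def windows_shift by (simp add: algebra_simps)
  also have "windows (\<lambda>j. pulse 1 (j + - 2 * int n)) (windows (pulse (int n)) t) =
      windows (\<lambda>j. pulse 1 (j + - 2 * int n) + pulse (int n) j) t" by (rule windows_add)
  also have "\<dots> = windows (pulse (int (Suc n))) t"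
    by (rule windows_cong) (auto simp: pulse_def)
  finally show ?case .
qed

lemma lift_mult:
  assumes "lift F \<in> carrier (Diff r (-(pi/2)) (pi/2))" "lift G \<in> carrier (Diff r (-(pi/2)) (pi/2))"
  shows "lift F \<otimes>\<^bsub>Diff r (-(pi/2)) (pi/2)\<^esub> lift G = lift (F \<circ> G)"
  using Diff_mult[OF assms] by (simp add: lift_comp)

lemma lift_one: "\<one>\<^bsub>Diff r (-(pi/2)) (pi/2)\<^esub> = lift id"
  by (simp add: Diff_one lift_id)

lemma lift_nat_pow:
  assumes "lift F \<in> carrier (Diff r (-(pi/2)) (pi/2))"
  shows "lift F [^]\<^bsub>Diff r (-(pi/2)) (pi/2)\<^esub> n = lift (F ^^ n)"
proof -
  interpret group "Diff r (-(pi/2)) (pi/2)" by (rule group_Diff)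
  show ?thesis
  proof (induction n)
    case (Suc n)
    have "lift (F ^^ n) \<in> carrier (Diff r (-(pi/2)) (pi/2))"
      using nat_pow_closed[OF assms, of n] Suc by simp
    from lift_mult[OF this assms] show ?case by (simp only: nat_pow_Suc Suc funpow_Suc_right)
  qed (simp add: lift_one id_def)
qed

lemma lift_inverse:
  assumes F: "lift F \<in> carrier (Diff r (-(pi/2)) (pi/2))" and FG: "F \<circ> G = id"
  shows "inv\<^bsub>Diff r (-(pi/2)) (pi/2)\<^esub> (lift F) = lift G"
proof -
  let ?G = "Diff r (-(pi/2)) (pi/2)"
  interpret group ?G by (rule group_Diff)
  let ?h = "inv\<^bsub>?G\<^esub> (lift F)"
  have h: "?h \<in> carrier ?G" using F by simp
  have hF': "compose J ?h (lift F) = (\<lambda>x\<in>J. x)"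
    using l_inv[OF F] Diff_mult[OF h F] by (simp add: Diff_one)
  have hF: "?h (lift F y) = y" if "y \<in> J" for y
  proof -
    have "?h (lift F y) = compose J ?h (lift F) y" using that by (simp add: compose_def)
    also have "\<dots> = y" unfolding hF' using that by simp
    finally show ?thesis .
  qed
  show ?thesis
  proof (rule ext)
    fix x
    show "?h x = lift G x"
    proof (cases "x \<in> J")
      case True
      have "lift F (lift G x) = x"
        using fun_cong[OF lift_comp[of F G], of x] True by (simp add: FG lift_id compose_eq del: atLeastAtMost_iff)
      then show ?thesis using hF[OF lift_mem[OF True, of G]] by simp
    next
      case False
      have "?h \<in> extensional J" using h by (simp add: Diff_def Bij_def)
      then have "?h x = undefined" using False by (rule extensional_arb)
      moreover have "lift G x = undefined" unfolding lift_def restrict_def using False by (simp only: if_False)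
      ultimately show ?thesis by simp
    qed
  qed
qed

lemma lift_diffeo_Diff: "lift diffeo \<in> carrier (Diff r (-(pi/2)) (pi/2))"
proof -
  interpret group "Diff r (-(pi/2)) (pi/2)" by (rule group_Diff)
  have T: "lift (\<lambda>t. t + (- 2 * pi)) \<in> carrier (Diff r (-(pi/2)) (pi/2))" by (rule translation_lift_Diff)
  have W: "lift (windows (pulse 1)) \<in> carrier (Diff r (-(pi/2)) (pi/2))"
    by (rule windows_lift_Diff[of _ 2]) (auto simp: pulse_def)
  have "diffeo = (\<lambda>t. t + (- 2 * pi)) \<circ> windows (pulse 1)" by (auto simp: diffeo_def)
  then show ?thesis using m_closed[OF T W] lift_mult[OF T W] by simp
qed

section \<open>Linear growth of the variation and undistortedness in class C^2\<close>

text \<open>The logarithm of dt/dx for t = tan x, the correction between log-derivatives in the two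
  coordinates.\<close>

definition log_square :: "real \<Rightarrow> real" where
  "log_square t = ln (1 + t\<^sup>2)"

lemma log_square_mono: "\<bar>s\<bar> \<le> \<bar>t\<bar> \<Longrightarrow> log_square s \<le> log_square t"
  unfolding log_square_def abs_le_square_iff by (intro ln_mono) (auto simp: add_pos_nonneg)

lemma log_square_nonneg: "log_square t \<ge> 0"
  using log_square_mono[of 0 t] by (simp add: log_square_def)

lemma sum_even_le:
  fixes h :: "nat \<Rightarrow> real"
  assumes "\<And>j. h j \<ge> 0" shows "(\<Sum>i<n. h (2 * i)) \<le> (\<Sum>j<2 * n. h j)"
proof (induction n)
  case (Suc n)
  have "(\<Sum>j<2 * Suc n. h j) = (\<Sum>j<2 * n. h j) + h (2 * n) + h (Suc (2 * n))" by simp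
  then show ?case using Suc assms[of "Suc (2 * n)"] by simp
qed simp

text \<open>In the coordinate \<open>t = tan x\<close> the derivative of \<open>f\<^sup>n\<close> oscillates between \<open>1\<close> and
  \<open>deriv (bump_flow 1) 0\<close> on each of the \<open>n\<close> windows of the orbit; passing to the coordinate \<open>x\<close>
  changes the variation of its logarithm by \<open>O(log n)\<close> only.\<close>

lemma log_variation_diffeo:
  assumes L: "log_variation L (-(pi/2)) (pi/2) (lift (diffeo ^^ Suc n))"
  shows "real n * (- ln (deriv (bump_flow 1) 0)) - 2 * log_square (2 * pi * real n + pi/2) \<le> L"
proof -
  define \<delta> where "\<delta> = - ln (deriv (bump_flow 1) 0)"
  define W where "W = windows (pulse (int (Suc n)))"
  define F where "F t = W t - 2 * pi * real (Suc n)" for t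
  have F: "diffeo ^^ Suc n = F" unfolding F_def[abs_def] W_def using diffeo_funpow by blast
  have dF: "(F has_real_derivative deriv W t) (at t)" for t
    unfolding F_def[abs_def] W_def
    using windows_C1(1)[of "pulse (int (Suc n))" t, OF abs_pulse_le] by (auto intro!: derivative_eq_intros)
  have Wpos: "deriv W t > 0" for t unfolding W_def by (rule deriv_windows_pos[OF abs_pulse_le])
  obtain f' where f': "\<And>x. x \<in> J \<Longrightarrow> (lift F has_real_derivative f' x) (at x within J)"
    "\<And>x N. mono x \<Longrightarrow> range x \<subseteq> J \<Longrightarrow> (\<Sum>j<N. \<bar>ln (f' (x (Suc j))) - ln (f' (x j))\<bar>) \<le> L"
    using L unfolding log_variation_def F by blast
  have lnf': "ln (f' (arctan t)) = ln (deriv W t) + log_square t - log_square (F t)" for t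
  proof -
    have d: "(lift F has_real_derivative deriv W t * (1 + t\<^sup>2) / (1 + (F t)\<^sup>2)) (at (arctan t))"
      using lift_has_deriv_interior[of F "deriv W t" "arctan t", unfolded tan_arctan, OF dF abs_arctan_less] .
    have "f' (arctan t) = deriv W t * (1 + t\<^sup>2) / (1 + (F t)\<^sup>2)"
      by (rule has_real_derivative_within_Icc_unique[OF _ arctan_mem_J f'(1)[OF arctan_mem_J]
          has_field_derivative_at_within[OF d]]) simp
    moreover have "1 + t\<^sup>2 > 0" "1 + (F t)\<^sup>2 > 0" by (simp_all add: add_pos_nonneg)
    ultimately show ?thesis using Wpos[of t] by (simp add: ln_mult ln_div log_square_def)
  qed
  \<comment> \<open>\<open>y (2 * i)\<close> is the left edge and \<open>y (2 * i + 1)\<close> the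
    centre of the window 2 i + 2, where the logarithm of the derivative of \<open>W\<close> is 0 and
    -\<delta>. Starting at window 2 keeps all points positive; the exponent \<open>Suc n\<close>
    leaves \<open>n\<close> such windows.\<close>
  define y where "y j = 2 * pi * (real (j div 2) + 1) - (if even j then pi/2 else 0)" for j :: nat
  have "mono y"
  proof (rule monoI[OF lift_Suc_mono_le])
    fix j show "y j \<le> y (Suc j)" using pi_gt_zero by (cases "even j") (auto simp: y_def algebra_simps elim!: oddE)
  qed
  then have "mono (\<lambda>j. arctan (y j))" by (simp add: mono_def arctan_le_iff)
  moreover have "range (\<lambda>j. arctan (y j)) \<subseteq> J" using arctan_mem_J by blast
  ultimately have "(\<Sum>j<2 * n. \<bar>ln (f' (arctan (y (Suc j)))) - ln (f' (arctan (y j)))\<bar>) \<le> L"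
    by (rule f'(2))
  then have sum: "(\<Sum>i<n. \<bar>ln (f' (arctan (y (Suc (2 * i))))) - ln (f' (arctan (y (2 * i))))\<bar>) \<le> L"
    using sum_even_le[of "\<lambda>j. \<bar>ln (f' (arctan (y (Suc j)))) - ln (f' (arctan (y j)))\<bar>" n] by simp
  \<comment> \<open>The corrections are compared with telescoping differences: \<open>A\<close> is
    exact at the centres and a lower bound at the left edges, \<open>B\<close> is exact at the
    images of the left edges and a lower bound at the images of the centres. Their sums leave only
    boundary terms of size O(log n).\<close>
  define A where "A i = log_square (2 * pi * real i)" for i
  define B where "B i = log_square (2 * pi * (real i - real n) - pi/2)" for i
  have step: "\<delta> - (A (Suc i) - A i) - (B i - B (Suc i)) \<le>
    \<bar>ln (f' (arctan (y (Suc (2 * i))))) - ln (f' (arctan (y (2 * i))))\<bar>" if "i < n" for i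
  proof -
    let ?j = "2 * int i + 2"
    have y: "y (2 * i) = pi * real_of_int ?j - pi/2" "y (Suc (2 * i)) = pi * real_of_int ?j"
      by (simp_all add: y_def algebra_simps)
    have w: "win (y (2 * i)) = ?j" "win (y (Suc (2 * i))) = ?j"
      unfolding win_eq_iff y using pi_gt_zero by auto
    have p: "pulse (int (Suc n)) ?j = 1" using that by (simp add: pulse_def)
    have d: "deriv W (y (2 * i)) = 1" "deriv W (y (Suc (2 * i))) = deriv (bump_flow 1) 0"
      unfolding W_def deriv_windows[OF abs_pulse_le] w p unfolding y
      by (simp_all add: deriv_bump_flow_outside)
    have F0: "F (y (2 * i)) = 2 * pi * (real i - real n) - pi/2"
      unfolding F_def W_def windows_def w p unfolding y by (simp add: bump_flow_outside algebra_simps)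
    have F1: "F (y (Suc (2 * i))) = 2 * pi * (real i - real n) + bump_flow 1 0"
      unfolding F_def W_def windows_def w p unfolding y by (simp add: algebra_simps)
    have "\<bar>bump_flow 1 0\<bar> < pi/2" by (rule bump_flow_inside) simp
    moreover have "pi * (real i - real n) \<le> pi * (- 1)" using that by (intro mult_left_mono) auto
    moreover have "2 * pi * (real (Suc i) - real n) - pi/2 = 2 * (pi * (real i - real n)) + 3 * pi/2"
      by (simp add: algebra_simps)
    moreover have "F (y (Suc (2 * i))) = 2 * (pi * (real i - real n)) + bump_flow 1 0"
      unfolding F1 by (simp add: algebra_simps)
    ultimately have "\<bar>2 * pi * (real (Suc i) - real n) - pi/2\<bar> \<le> \<bar>F (y (Suc (2 * i)))\<bar>"
      using pi_gt_zero by linarith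
    then have b: "B (Suc i) \<le> log_square (F (y (Suc (2 * i))))" unfolding B_def by (rule log_square_mono)
    have "y (2 * i) = 2 * pi * real i + 3 * pi/2" unfolding y by (simp add: algebra_simps)
    moreover have "2 * pi * real i \<ge> 0" by simp
    ultimately have "\<bar>2 * pi * real i\<bar> \<le> \<bar>y (2 * i)\<bar>" using pi_gt_zero by linarith
    then have a: "A i \<le> log_square (y (2 * i))" unfolding A_def by (rule log_square_mono)
    have "2 * pi * real (Suc i) = y (Suc (2 * i))" unfolding y by (simp add: algebra_simps)
    then have "A (Suc i) = log_square (y (Suc (2 * i)))" by (simp only: A_def)
    moreover have "B i = log_square (F (y (2 * i)))" by (simp add: B_def F0)
    ultimately have "ln (f' (arctan (y (Suc (2 * i))))) - ln (f' (arctan (y (2 * i)))) \<le>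
      - \<delta> + (A (Suc i) - A i) + (B i - B (Suc i))"
      using a b unfolding lnf' d \<delta>_def by simp
    then show ?thesis by linarith
  qed
  have "(\<Sum>i<n. \<delta> - (A (Suc i) - A i) - (B i - B (Suc i))) \<le> L"
    using sum_mono[of "{..<n}", OF step] sum by (meson lessThan_iff order_trans)
  moreover have "(\<Sum>i<n. \<delta> - (A (Suc i) - A i) - (B i - B (Suc i))) =
      real n * \<delta> - (A n - A 0) - (B 0 - B n)"
    by (simp only: sum_subtractf[where f = "\<lambda>i. \<delta> - (A (Suc i) - A i)"] sum_subtractf[where f = "\<lambda>i. \<delta>"]
        sum_lessThan_telescope sum_lessThan_telescope') simp
  moreover have "A n \<le> log_square (2 * pi * real n + pi/2)"
    unfolding A_def by (intro log_square_mono) simp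
  moreover have "B 0 \<le> log_square (2 * pi * real n + pi/2)"
    unfolding B_def by (intro log_square_mono) (simp add: algebra_simps abs_if)
  moreover have "A 0 \<ge> 0" "B n \<ge> 0" by (simp_all add: A_def B_def log_square_nonneg)
  ultimately show ?thesis unfolding \<delta>_def[symmetric] by linarith
qed

lemma diffeo_undistorted: "undistorted_in (Diff 2 (-(pi/2)) (pi/2)) (lift diffeo)"
  unfolding undistorted_in_def
proof
  show "lift diffeo \<in> carrier (Diff 2 (-(pi/2)) (pi/2))" by (rule lift_diffeo_Diff)
  show "\<not> distorted_in (Diff 2 (-(pi/2)) (pi/2)) (lift diffeo)"
  proof
    assume "distorted_in (Diff 2 (-(pi/2)) (pi/2)) (lift diffeo)"
    from distorted_imp_sublinear_log_variation[OF _ this]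
    obtain L where L: "\<And>n. log_variation (L n) (-(pi/2)) (pi/2) (lift (diffeo ^^ n))" "(\<lambda>n. L n / real n) \<longlonglongrightarrow> 0"
      by (auto simp: lift_nat_pow[OF lift_diffeo_Diff])
    define \<delta> where "\<delta> = - ln (deriv (bump_flow 1) 0)"
    have "\<delta> > 0" using deriv_bump_flow_1_0 deriv_bump_flow_pos[of 1 0] by (simp add: \<delta>_def)
    \<comment> \<open>Divided by \<open>Suc n\<close>, the lower bound of
      \<open>log_variation_diffeo\<close> tends to \<delta>, as its logarithmic term is negligible,
      while the sublinear upper bound tends to 0.\<close>
    have "\<delta> \<le> 0"
    proof (rule LIMSEQ_le)
      show "(\<lambda>n. (real n * \<delta> - 2 * ln (1 + (2 * pi * real n + pi/2)\<^sup>2)) / real (Suc n)) \<longlonglongrightarrow> \<delta>"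
        using pi_gt_zero by real_asymp
      show "(\<lambda>n. L (Suc n) / real (Suc n)) \<longlonglongrightarrow> 0" by (rule LIMSEQ_Suc[OF L(2)])
      have "(real n * \<delta> - 2 * ln (1 + (2 * pi * real n + pi/2)\<^sup>2)) / real (Suc n) \<le> L (Suc n) / real (Suc n)" for n
        using log_variation_diffeo[OF L(1)] unfolding \<delta>_def log_square_def by (intro divide_right_mono) auto
      then show "\<exists>N. \<forall>n\<ge>N. (real n * \<delta> - 2 * ln (1 + (2 * pi * real n + pi/2)\<^sup>2)) / real (Suc n) \<le> L (Suc n) / real (Suc n)"
        by blast
    qed
    then show False using \<open>\<delta> > 0\<close> by simp
  qed
qed


subsection \<open>Short words\<close>

abbreviation Diff1 :: "(real \<Rightarrow> real) monoid" where
  "Diff1 \<equiv> Diff 1 (-(pi/2)) (pi/2)"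

text \<open>An upper bound in place of the minimal length: such bounds simply add under composition,
  and \<open>F\<close> remains a map of the line.\<close>

definition short :: "(real \<Rightarrow> real) set \<Rightarrow> nat \<Rightarrow> (real \<Rightarrow> real) \<Rightarrow> bool" where
  "short S n F \<longleftrightarrow> (\<exists>w. length w \<le> n \<and> set w \<subseteq> S \<union> (\<lambda>s. inv\<^bsub>Diff1\<^esub> s) ` S \<and>
     foldr (\<lambda>x y. x \<otimes>\<^bsub>Diff1\<^esub> y) w \<one>\<^bsub>Diff1\<^esub> = lift F)"

lemma short_imp_word_length_le: "short S n F \<Longrightarrow> word_length Diff1 S (lift F) \<le> n"
proof -
  assume "short S n F"
  then obtain w where w: "length w \<le> n" "set w \<subseteq> S \<union> (\<lambda>s. inv\<^bsub>Diff1\<^esub> s) ` S"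
    "foldr (\<lambda>x y. x \<otimes>\<^bsub>Diff1\<^esub> y) w \<one>\<^bsub>Diff1\<^esub> = lift F" unfolding short_def by blast
  have "word_length Diff1 S (lift F) \<le> length w"
    unfolding word_length_def by (rule Least_le) (use w in blast)
  then show ?thesis using w(1) by simp
qed

lemma short_mono: "short S m F \<Longrightarrow> m \<le> n \<Longrightarrow> short S n F"
  unfolding short_def by (meson order_trans)

lemma short_id: "short S 0 (\<lambda>t. t)"
  unfolding short_def using lift_one[of 1] by (intro exI[of _ "[]"]) (simp add: id_def)

lemma short_comp:
  assumes S: "S \<subseteq> carrier Diff1" and "short S m F" "short S n G"
  shows "short S (m + n) (\<lambda>t. F (G t))"
proof -
  interpret group Diff1 by (rule group_Diff)
  let ?A = "S \<union> (\<lambda>s. inv\<^bsub>Diff1\<^esub> s) ` S"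
  obtain u v where uv: "length u \<le> m" "set u \<subseteq> ?A" "foldr (\<lambda>x y. x \<otimes>\<^bsub>Diff1\<^esub> y) u \<one>\<^bsub>Diff1\<^esub> = lift F"
    "length v \<le> n" "set v \<subseteq> ?A" "foldr (\<lambda>x y. x \<otimes>\<^bsub>Diff1\<^esub> y) v \<one>\<^bsub>Diff1\<^esub> = lift G"
    using assms(2,3) unfolding short_def by blast
  have A: "?A \<subseteq> carrier Diff1" using S by auto
  have u: "set u \<subseteq> carrier Diff1" and v: "set v \<subseteq> carrier Diff1" using uv A by blast+
  have "foldr (\<lambda>x y. x \<otimes>\<^bsub>Diff1\<^esub> y) (u @ v) \<one>\<^bsub>Diff1\<^esub> = lift F \<otimes>\<^bsub>Diff1\<^esub> lift G"
    using foldr_mult_append[OF u v] uv by simp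
  also have "\<dots> = lift (\<lambda>t. F (G t))"
    using lift_mult[of F 1 G] foldr_mult_closed[OF u] foldr_mult_closed[OF v] uv by (simp add: o_def)
  finally show ?thesis unfolding short_def using uv by (intro exI[of _ "u @ v"]) auto
qed

lemma short_generator:
  assumes "S \<subseteq> carrier Diff1" "lift F \<in> S" shows "short S 1 F"
proof -
  interpret group Diff1 by (rule group_Diff)
  have "lift F \<in> carrier Diff1" using assms by blast
  then show ?thesis unfolding short_def using assms by (intro exI[of _ "[lift F]"]) simp
qed

lemma short_inverse:
  assumes "S \<subseteq> carrier Diff1" "lift F \<in> S" "\<And>t. F (G t) = t" shows "short S 1 G"
proof -
  interpret group Diff1 by (rule group_Diff)
  have F: "lift F \<in> carrier Diff1" using assms by blast
  have "F \<circ> G = id" using assms(3) by auto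
  from lift_inverse[OF F this] have "inv\<^bsub>Diff1\<^esub> (lift F) = lift G" .
  moreover have "inv\<^bsub>Diff1\<^esub> (lift F) \<in> carrier Diff1" using F by simp
  ultimately show ?thesis
    unfolding short_def using assms(2) by (intro exI[of _ "[lift G]"]) (auto intro: rev_image_eqI)
qed

text \<open>Doubling in the Baumslag--Solitar group generated by \<open>t \<mapsto> t + 2\<pi>\<close> and \<open>t \<mapsto> 2t\<close>.\<close>

lemma short_translation:
  assumes S: "S \<subseteq> carrier Diff1" and "lift (\<lambda>t. t + 2 * pi) \<in> S" "lift (\<lambda>t. 2 * t) \<in> S"
  shows "n < 2 ^ k \<Longrightarrow> short S (3 * k) (\<lambda>t. t + 2 * pi * real n) \<and> short S (3 * k) (\<lambda>t. t - 2 * pi * real n)"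
proof (induction k arbitrary: n)
  case 0
  then show ?case using short_id by simp
next
  case (Suc k)
  have T: "short S 1 (\<lambda>t. t + 2 * pi)" and T': "short S 1 (\<lambda>t. t - 2 * pi)"
    and D: "short S 1 (\<lambda>t. 2 * t)" and D': "short S 1 (\<lambda>t. t / 2)"
    using short_generator[OF S assms(2)] short_inverse[OF S assms(2), of "\<lambda>t. t - 2 * pi"]
      short_generator[OF S assms(3)] short_inverse[OF S assms(3), of "\<lambda>t. t / 2"] by simp_all
  define q where "q = n div 2"
  have "q < 2 ^ k" using Suc.prems unfolding q_def by auto
  note IH = Suc.IH[OF this]
  \<comment> \<open>Conjugation by the dilation doubles a translation at the cost of two letters,
    and an odd digit takes a third: at most 3 letters per binary digit.\<close>
  have even: "short S (1 + (3 * k + 1)) (\<lambda>t. 2 * (t / 2 + 2 * pi * real q))"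
    "short S (1 + (3 * k + 1)) (\<lambda>t. 2 * (t / 2 - 2 * pi * real q))"
    by (rule short_comp[OF S D short_comp[OF S IH[THEN conjunct1] D']],
        rule short_comp[OF S D short_comp[OF S IH[THEN conjunct2] D']])
  have odd: "short S (1 + (1 + (3 * k + 1))) (\<lambda>t. 2 * (t / 2 + 2 * pi * real q) + 2 * pi)"
    "short S (1 + (1 + (3 * k + 1))) (\<lambda>t. 2 * (t / 2 - 2 * pi * real q) - 2 * pi)"
    by (rule short_comp[OF S T even(1)], rule short_comp[OF S T' even(2)])
  show ?case
  proof (cases "even n")
    case True
    then have "n = 2 * q" by (simp add: q_def)
    then have "(\<lambda>t. 2 * (t / 2 + 2 * pi * real q)) = (\<lambda>t. t + 2 * pi * real n)"
      "(\<lambda>t. 2 * (t / 2 - 2 * pi * real q)) = (\<lambda>t. t - 2 * pi * real n)" by (simp_all add: algebra_simps)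
    then show ?thesis using even by (auto intro: short_mono)
  next
    case False
    then have "n = 2 * q + 1" by (simp add: q_def odd_two_times_div_two_succ)
    then have "(\<lambda>t. 2 * (t / 2 + 2 * pi * real q) + 2 * pi) = (\<lambda>t. t + 2 * pi * real n)"
      "(\<lambda>t. 2 * (t / 2 - 2 * pi * real q) - 2 * pi) = (\<lambda>t. t - 2 * pi * real n)" by (simp_all add: algebra_simps)
    then show ?thesis using odd by (auto intro: short_mono)
  qed
qed

section \<open>The ladder, its commutators and the powers of the diffeomorphism\<close>

text \<open>Only even windows are occupied, so that a shift by one window moves every rung to a free
  window and the transition window \<open>2 * p - 1\<close> is free as well.\<close>

definition ladder :: "(nat \<Rightarrow> nat) \<Rightarrow> int \<Rightarrow> real" where
  "ladder m j = (if 0 \<le> j \<and> even j then 1 / real (m (nat (j div 2))) else 0)"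

text \<open>The times 1 / m i and -1 / m i on the windows 2 i and 2 i + 1, for all i \<ge> p: h at
  time 1 / m i on every later pair.\<close>

definition tail :: "(nat \<Rightarrow> nat) \<Rightarrow> nat \<Rightarrow> int \<Rightarrow> real" where
  "tail m p j = (if j < 2 * int p then 0 else ladder m j - ladder m (j - 1))"

definition gens :: "(nat \<Rightarrow> nat) \<Rightarrow> (real \<Rightarrow> real) set" where
  "gens m = {lift (\<lambda>t. t + 2 * pi), lift (\<lambda>t. 2 * t), lift half_shift, lift (windows (ladder m)), lift diffeo}"

lemma abs_ladder_le: "(\<And>i. m i \<ge> 1) \<Longrightarrow> \<bar>ladder m j\<bar> \<le> 1"
  by (simp add: ladder_def divide_le_eq_1) (meson gr0I not_one_le_zero)

lemma ladder_tendsto: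
  assumes m: "filterlim m at_top sequentially"
  shows "(\<lambda>n. ladder m (int n)) \<longlonglongrightarrow> 0"
proof (rule Lim_null_comparison)
  have "filterlim (\<lambda>n::nat. n div 2) at_top sequentially"
    unfolding filterlim_at_top
  proof
    fix Z :: nat
    show "\<forall>\<^sub>F n in sequentially. Z \<le> n div 2"
      using eventually_ge_at_top[of "2 * Z"] by eventually_elim auto
  qed
  then have "filterlim (\<lambda>n. real (m (n div 2))) at_top sequentially"
    by (intro filterlim_compose[OF filterlim_real_sequentially] filterlim_compose[OF m])
  then show "(\<lambda>n. inverse (real (m (n div 2)))) \<longlonglongrightarrow> 0" by (rule tendsto_inverse_0_at_top)
  show "\<forall>\<^sub>F n in sequentially. norm (ladder m (int n)) \<le> inverse (real (m (n div 2)))"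
    by (auto simp: ladder_def divide_inverse nat_div_distrib)
qed

lemma gens_subset:
  assumes "\<And>i. m i \<ge> 1" "filterlim m at_top sequentially"
  shows "gens m \<subseteq> carrier Diff1"
proof -
  have "chart_C1 (windows (ladder m)) (deriv (windows (ladder m))) 1 1"
    by (rule windows_chart_C1[OF abs_ladder_le[OF assms(1)] _ ladder_tendsto[OF assms(2)]])
      (simp add: ladder_def)
  then show ?thesis
    using lift_in_Diff1 half_shift_chart_C1 scaling_chart_C1[of 2] translation_lift_Diff lift_diffeo_Diff
    by (auto simp: gens_def)
qed

text \<open>Conjugating the ladder by the half shift moves its part beyond the window \<open>2p\<close> off itself,
  so that the commutator is supported there.\<close>

lemma short_tail:
  assumes m: "\<And>i. m i \<ge> 1" "filterlim m at_top sequentially" and p: "p < 2 ^ k"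
  shows "short (gens m) (12 * k + 4) (windows (tail m p))"
    and "short (gens m) (12 * k + 4) (windows (\<lambda>j. - tail m p j))"
proof -
  note S = gens_subset[OF m]
  let ?S = "gens m" and ?a = "ladder m"
  have T: "short ?S (3 * k) (\<lambda>t. t + 2 * pi * real p)" "short ?S (3 * k) (\<lambda>t. t - 2 * pi * real p)"
    using short_translation[OF S _ _ p] by (auto simp: gens_def)
  define U where "U = inv_into UNIV half_shift"
  have bij: "bij half_shift" using chart_C1_bij[OF half_shift_chart_C1] by blast
  have VU: "half_shift (U t) = t" for t
    unfolding U_def using bij by (simp add: bij_is_surj surj_f_inv_f)
  have V: "short ?S 1 half_shift" "short ?S 1 U"
    using short_generator[OF S, of half_shift] short_inverse[OF S, of half_shift U] VU by (auto simp: gens_def)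
  have A: "short ?S 1 (windows ?a)" "short ?S 1 (windows (\<lambda>j. - ?a j))"
    using short_generator[OF S, of "windows ?a"] short_inverse[OF S, of "windows ?a" "windows (\<lambda>j. - ?a j)"]
    by (auto simp: gens_def windows_add windows_eq_self)
  define Vp where "Vp = half_shift_at (int p)"
  define Up where "Up t = U (t - 2 * pi * real p) + 2 * pi * real p" for t
  have VUp: "Vp (Up t) = t" for t by (simp add: Vp_def Up_def half_shift_at_def VU)
  have sV: "short ?S (3 * k + (1 + 3 * k)) Vp"
    using short_comp[OF S T(1) short_comp[OF S V(1) T(2)]] by (simp add: Vp_def half_shift_at_def[abs_def])
  have sU: "short ?S (3 * k + (1 + 3 * k)) Up"
    using short_comp[OF S T(1) short_comp[OF S V(2) T(2)]] by (simp add: Up_def[abs_def])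
  let ?n = "3 * k + (1 + 3 * k)"
  have a0: "?a (2 * int p - 1) = 0" by (simp add: ladder_def)
  have conj: "Vp (windows c (Up t)) = windows (\<lambda>j. if j < 2 * int p then c j else c (j - 1)) t"
    if "c (2 * int p - 1) = 0" for c t
    using half_shift_at_windows[of c "int p" "Up t"] that VUp by (simp add: Vp_def)
  \<comment> \<open>The commutator of the ladder with \<open>Vp\<close>: below the window 2 p the
    two factors cancel, and beyond it the inverse ladder appears shifted by one window.\<close>
  have "windows ?a (Vp (windows (\<lambda>j. - ?a j) (Up t))) = windows (tail m p) t" for t
    unfolding conj[of "\<lambda>j. - ?a j", simplified, OF a0] windows_add
    by (rule windows_cong) (simp add: tail_def)
  \<comment> \<open>Two ladder letters and two conjugates of length 6 k + 1 make 12 k + 4.\<close>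
  moreover have "short ?S (1 + (?n + (1 + ?n))) (\<lambda>t. windows ?a (Vp (windows (\<lambda>j. - ?a j) (Up t))))"
    by (intro short_comp[OF S] A sV sU)
  ultimately show "short ?S (12 * k + 4) (windows (tail m p))" by (auto intro: short_mono)
  \<comment> \<open>The inverse commutator, as an explicit word of the same length.\<close>
  have "Vp (windows ?a (Up (windows (\<lambda>j. - ?a j) t))) = windows (\<lambda>j. - tail m p j) t" for t
    unfolding conj[of ?a, OF a0] windows_add
    by (rule windows_cong) (simp add: tail_def)
  moreover have "short ?S (?n + (1 + (?n + 1))) (\<lambda>t. Vp (windows ?a (Up (windows (\<lambda>j. - ?a j) t))))"
    by (intro short_comp[OF S] A sV sU)
  ultimately show "short ?S (12 * k + 4) (windows (\<lambda>j. - tail m p j))" by (auto intro: short_mono)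
qed

lemma short_windows_sum:
  assumes S: "S \<subseteq> carrier Diff1" and c: "\<And>q. q < M \<Longrightarrow> short S l (windows (c q))"
  shows "short S (M * l) (windows (\<lambda>j. \<Sum>q<M. c q j))"
  using c
proof (induction M)
  case 0
  have "windows (\<lambda>j. 0) = (\<lambda>t. t)" by (auto simp: windows_eq_self)
  then show ?case using short_id by simp
next
  case (Suc M)
  have "short S (l + M * l) (\<lambda>t. windows (c M) (windows (\<lambda>j. \<Sum>q<M. c q j) t))"
    using Suc by (intro short_comp[OF S]) auto
  then show ?case by (simp add: windows_add add.commute)
qed

text \<open>The window \<open>i < n\<close> is covered by exactly \<open>m i\<close> of the \<open>m n\<close> factors, each of which
  contributes \<open>1 / m i\<close> there.\<close>

lemma pulse_eq_sum:
  fixes m :: "nat \<Rightarrow> nat"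
  assumes m1: "\<And>i. m i \<ge> 1" and mono: "mono m"
  defines "N \<equiv> \<lambda>q. LEAST i. Suc q \<le> m i"
  shows "pulse (int n) j = (\<Sum>q<m n. tail m (N q) j - tail m n j)"
    and "q < m n \<Longrightarrow> N q \<le> n"
proof -
  show Nn: "N q \<le> n" if "q < m n" for q n unfolding N_def using that by (intro Least_le) simp
  \<comment> \<open>The factor \<open>q\<close> acts from the pair \<open>N q\<close> on; by
    monotonicity of \<open>m\<close> it reaches the pair \<open>i\<close> exactly when q < m i, so
    \<open>m i\<close> factors act there.\<close>
  have N: "N q \<le> i \<longleftrightarrow> q < m i" if "q < m n" for q i
  proof
    have "Suc q \<le> m (N q)" unfolding N_def by (rule LeastI[of _ n]) (use that in simp)
    moreover assume "N q \<le> i"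
    ultimately show "q < m i" using monoD[OF mono, of "N q" i] by simp
  qed (rule Nn)
  consider "j < 0" | "0 \<le> j" "j < 2 * int n" | "2 * int n \<le> j" by linarith
  then show "pulse (int n) j = (\<Sum>q<m n. tail m (N q) j - tail m n j)"
  proof cases
    case 1
    then show ?thesis by (simp add: pulse_def tail_def)
  next
    case 2
    define i where "i = nat (j div 2)"
    have i: "j = 2 * int i \<or> j = 2 * int i + 1" using 2 unfolding i_def by auto
    define s :: real where "s = (if even j then 1 else - 1) / real (m i)"
    have t: "tail m p j = (if p \<le> i then s else 0)" for p
      using i by (elim disjE) (simp_all add: tail_def ladder_def s_def nat_add_distrib)
    have "(\<Sum>q<m n. tail m (N q) j - tail m n j) = (\<Sum>q<m n. if q < m i then s else 0)"
    proof (rule sum.cong[OF refl])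
      fix q assume "q \<in> {..<m n}"
      moreover have "\<not> n \<le> i" using 2 i by auto
      ultimately show "tail m (N q) j - tail m n j = (if q < m i then s else 0)" using N by (simp add: t)
    qed
    also have "\<dots> = (\<Sum>q\<in>{..<m n} \<inter> {q. q < m i}. s)" using sum.inter_restrict[of "{..<m n}" "\<lambda>_. s" "{q. q < m i}"] by simp
    also have "{..<m n} \<inter> {q. q < m i} = {..<m i}"
      using monoD[OF mono, of i n] 2 i by auto
    also have "(\<Sum>q<m i. s) = pulse (int n) j" using m1[of i] 2 by (simp add: s_def pulse_def)
    finally show ?thesis by simp
  next
    case 3
    \<comment> \<open>Beyond the first 2 n windows the two tails coincide, which truncates each
      factor to finitely many windows.\<close>
    have "tail m (N q) j - tail m n j = 0" if "q < m n" for q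
      using Nn[OF that] 3 by (simp add: tail_def)
    then show ?thesis using 3 by (simp add: pulse_def)
  qed
qed

lemma short_diffeo_funpow:
  assumes m: "\<And>i. m i \<ge> 1" "filterlim m at_top sequentially" "mono m" and n: "n < 2 ^ k"
  shows "short (gens m) (3 * k + m n * (24 * k + 8)) (diffeo ^^ n)"
proof -
  note S = gens_subset[OF m(1,2)]
  define N where "N q = (LEAST i. Suc q \<le> m i)" for q
  have pulse: "pulse (int n) = (\<lambda>j. \<Sum>q<m n. tail m (N q) j - tail m n j)"
    using pulse_eq_sum(1)[OF m(1,3)] unfolding N_def by blast
  have "short (gens m) (24 * k + 8) (windows (\<lambda>j. tail m (N q) j - tail m n j))" if "q < m n" for q
  proof -
    have "N q < 2 ^ k" using pulse_eq_sum(2)[OF m(1,3) that] n unfolding N_def by simp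
    from short_comp[OF S short_tail(1)[OF m(1,2) this] short_tail(2)[OF m(1,2) n]]
    show ?thesis by (simp add: windows_add)
  qed
  then have "short (gens m) (m n * (24 * k + 8)) (windows (pulse (int n)))"
    unfolding pulse by (rule short_windows_sum[OF S])
  moreover have "short (gens m) (3 * k) (\<lambda>t. t - 2 * pi * real n)"
    using short_translation[OF S _ _ n] by (auto simp: gens_def)
  ultimately have "short (gens m) (3 * k + m n * (24 * k + 8)) (\<lambda>t. windows (pulse (int n)) t - 2 * pi * real n)"
    by (intro short_comp[OF S])
  also have "(\<lambda>t. windows (pulse (int n)) t - 2 * pi * real n) = diffeo ^^ n"
    by (rule ext) (simp add: diffeo_funpow)
  finally show ?thesis .
qed

lemma word_length_diffeo_le:
  assumes m: "\<And>i. m i \<ge> 1" "filterlim m at_top sequentially" "mono m" and n: "n \<ge> 3"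
  shows "real (word_length Diff1 (gens m) (lift (diffeo ^^ n))) \<le> 89 * real (m n) * ln (real n)"
proof -
  obtain l where l: "2 ^ l \<le> n" "n < 2 ^ (l + 1)" using ex_power_ivl1[of 2 n] n by auto
  have "3 \<le> real n" using n by simp
  then have "exp (1::real) \<le> real n" using exp_le by linarith
  \<comment> \<open>From n \<ge> 3 > e on, additive constants can be absorbed into multiples of ln
    n.\<close>
  then have ln1: "1 \<le> ln (real n)" using n by (subst ln_ge_iff) auto
  have "(2::real) ^ l \<le> real n" using l(1) by (metis of_nat_le_iff of_nat_numeral of_nat_power)
  then have "ln (2 ^ l :: real) \<le> ln (real n)" by (intro ln_mono) auto
  then have "real l * ln 2 \<le> ln (real n)" by (simp add: ln_realpow)
  moreover have "real l * (1/2) \<le> real l * ln 2" using ln2_ge_two_thirds by (intro mult_left_mono) auto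
  ultimately have k: "real (l + 1) \<le> 3 * ln (real n)" using ln1 by simp
  have m1: "real (m n) \<ge> 1" using m(1)[of n] by simp
  have "real (word_length Diff1 (gens m) (lift (diffeo ^^ n))) \<le> real (3 * (l + 1) + m n * (24 * (l + 1) + 8))"
    using short_imp_word_length_le[OF short_diffeo_funpow[OF m l(2)]] by (rule of_nat_mono)
  also have "\<dots> = 3 * real (l + 1) + real (m n) * (24 * real (l + 1) + 8)" by simp
  also have "\<dots> \<le> real (m n) * (3 * real (l + 1)) + real (m n) * (24 * real (l + 1) + 8)"
    using mult_right_mono[OF m1, of "3 * real (l + 1)"] by simp
  also have "\<dots> = real (m n) * (27 * real (l + 1) + 8)" by (simp add: algebra_simps)
  \<comment> \<open>With l + 1 \<le> 3 ln n and 1 \<le> ln n, the constant is 89 = 27 * 3 +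
    8.\<close>
  also have "\<dots> \<le> real (m n) * (89 * ln (real n))" using k ln1 by (intro mult_left_mono) auto
  finally show ?thesis by (simp add: mult_ac)
qed

section \<open>A slowly growing sequence and the conclusion\<close>

text \<open>The square leaves room for the little-o: slow / k is at most 1 / slow. Quantifying over
  all later indices makes the sequence monotone, and the cap x \<le> n makes the set finite.\<close>

definition slow :: "(nat \<Rightarrow> nat) \<Rightarrow> nat \<Rightarrow> nat" where
  "slow k n = Max {x. x \<le> n \<and> (\<forall>i\<ge>n. x\<^sup>2 \<le> k i)}"

lemma slow_mem: "slow k n \<le> n \<and> (\<forall>i\<ge>n. (slow k n)\<^sup>2 \<le> k i)"
proof -
  have "finite {x. x \<le> n \<and> (\<forall>i\<ge>n. x\<^sup>2 \<le> k i)}" "0 \<in> {x. x \<le> n \<and> (\<forall>i\<ge>n. x\<^sup>2 \<le> k i)}" by auto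
  from Max_in[OF this(1)] this(2) show ?thesis unfolding slow_def by blast
qed

lemma le_slow: "x \<le> n \<Longrightarrow> (\<And>i. i \<ge> n \<Longrightarrow> x\<^sup>2 \<le> k i) \<Longrightarrow> x \<le> slow k n"
  unfolding slow_def by (intro Max_ge) auto

lemma mono_slow: "mono (slow k)"
proof (rule monoI)
  fix n n' :: nat assume "n \<le> n'"
  then show "slow k n \<le> slow k n'" using slow_mem[of k n] by (intro le_slow) auto
qed

lemma slow_at_top:
  assumes "filterlim k at_top sequentially" shows "filterlim (slow k) at_top sequentially"
  unfolding filterlim_at_top
proof
  fix Z :: nat
  have "\<forall>\<^sub>F n in sequentially. Z\<^sup>2 \<le> k n" using assms unfolding filterlim_at_top by blast
  then obtain n0 where n0: "\<And>n. n \<ge> n0 \<Longrightarrow> Z\<^sup>2 \<le> k n" unfolding eventually_sequentially by blast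
  show "\<forall>\<^sub>F n in sequentially. Z \<le> slow k n"
    using eventually_ge_at_top[of "max Z n0"] by eventually_elim (intro le_slow n0; simp)
qed

theorem mainTheorem2:
  shows "\<exists>(a::real) (b::real) (f :: real \<Rightarrow> real).
    a < b \<and>
    f \<in> carrier (Diff \<infinity> a b) \<and>
    undistorted_in (Diff 2 a b) f \<and>
    (\<forall>k :: nat \<Rightarrow> nat.
       (\<forall>n\<ge>1. 0 < k n) \<longrightarrow> filterlim k at_top sequentially \<longrightarrow>
       (\<exists>\<Gamma> S. subgroup \<Gamma> (Diff 1 a b) \<and> finite_generating_set (Diff 1 a b) \<Gamma> S \<and> f \<in> \<Gamma> \<and>
          (\<lambda>n. real (word_length (Diff 1 a b) S (f [^]\<^bsub>Diff 1 a b\<^esub> n)))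
            \<in> o(\<lambda>n. real (k n) * ln (real n))))"
proof (rule exI[of _ "-(pi/2)"], rule exI[of _ "pi/2"], rule exI[of _ "lift diffeo"], intro conjI allI impI)
  show "lift diffeo \<in> carrier (Diff \<infinity> (-(pi/2)) (pi/2))" by (rule lift_diffeo_Diff)
  show "undistorted_in (Diff 2 (-(pi/2)) (pi/2)) (lift diffeo)" by (rule diffeo_undistorted)
next
  fix k :: "nat \<Rightarrow> nat" assume k: "filterlim k at_top sequentially"
  interpret group Diff1 by (rule group_Diff)
  \<comment> \<open>The successor keeps the denominators 1 / m i meaningful, and m \<le> 2 slow as
    soon as slow \<ge> 1.\<close>
  define m where "m n = Suc (slow k n)" for n
  have m: "\<And>i. m i \<ge> 1" "mono m" using mono_slow[of k] by (auto simp: m_def mono_def)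
  have mt: "filterlim m at_top sequentially"
    unfolding m_def by (rule filterlim_at_top_mono[OF slow_at_top[OF k]]) simp
  note S = gens_subset[OF m(1) mt]
  have "(\<lambda>n. real (word_length Diff1 (gens m) (lift (diffeo ^^ n)))) \<in> o(\<lambda>n. real (k n) * ln (real n))"
  proof (rule landau_o.smallI)
    fix c :: real assume c: "c > 0"
    \<comment> \<open>Here 178 = 2 * 89. Once slow \<ge> Z, one has 89 m \<le> 178 slow \<le> c
      slow^2 \<le> c k; the successor also ensures slow \<ge> 1.\<close>
    define Z where "Z = Suc (nat \<lceil>178 / c\<rceil>)"
    have "\<forall>\<^sub>F n in sequentially. Z \<le> slow k n" using slow_at_top[OF k] unfolding filterlim_at_top by blast
    then show "\<forall>\<^sub>F n in sequentially. norm (real (word_length Diff1 (gens m) (lift (diffeo ^^ n))))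
      \<le> c * norm (real (k n) * ln (real n))"
      using eventually_ge_at_top[of 3]
    proof eventually_elim
      case (elim n)
      let ?x = "real (slow k n)"
      have "178 / c \<le> real Z" unfolding Z_def by linarith
      then have x: "178 / c \<le> ?x" "1 \<le> ?x" using elim(1) unfolding Z_def by linarith+
      have ln: "ln (real n) \<ge> 0" using elim(2) by simp
      have "89 * real (m n) \<le> 178 * ?x" using x(2) by (simp add: m_def)
      also have "\<dots> \<le> c * ?x * ?x" using x c by (intro mult_right_mono) (auto simp: field_simps)
      also have "\<dots> \<le> c * real (k n)"
      proof -
        have "(slow k n)\<^sup>2 \<le> k n" using slow_mem[of k n] by blast
        then have "?x * ?x \<le> real (k n)" by (metis of_nat_le_iff of_nat_mult power2_eq_square)
        then show ?thesis using c by simp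
      qed
      finally have "89 * real (m n) * ln (real n) \<le> c * real (k n) * ln (real n)"
        using ln by (rule mult_right_mono)
      then show ?case using word_length_diffeo_le[OF m(1) mt m(2) elim(2)] ln by (simp add: abs_mult mult_ac)
    qed
  qed
  then have "(\<lambda>n. real (word_length Diff1 (gens m) (lift diffeo [^]\<^bsub>Diff1\<^esub> n))) \<in> o(\<lambda>n. real (k n) * ln (real n))"
    by (simp add: lift_nat_pow[OF lift_diffeo_Diff])
  moreover have "subgroup (generate Diff1 (gens m)) Diff1" using S by (rule generate_is_subgroup)
  moreover have "finite_generating_set Diff1 (generate Diff1 (gens m)) (gens m)"
    using S by (simp add: finite_generating_set_def gens_def)
  moreover have "lift diffeo \<in> generate Diff1 (gens m)" by (rule generate.incl) (simp add: gens_def)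
  ultimately show "\<exists>\<Gamma> S. subgroup \<Gamma> Diff1 \<and> finite_generating_set Diff1 \<Gamma> S \<and> lift diffeo \<in> \<Gamma> \<and>
      (\<lambda>n. real (word_length Diff1 S (lift diffeo [^]\<^bsub>Diff1\<^esub> n))) \<in> o(\<lambda>n. real (k n) * ln (real n))"
    by blast
qed simp

end
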